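(* Suppose that $G$ is a Cayley graph (or more generally, a unimodular transitive graph) with vertex set $V$ and degree $d$. Let $\tau$ denote the normalized edge Cheeger constant $$\tau=\inf_{W\subset V;\ |W|<\infty}\frac{|\partial W|}{d|W|}.$$ Then the density of any factor-of-IID independent set in $G$ is at most $\varphi^{-1}(\tau)$, where $\varphi^{-1}$ is the inverse of the function $$\varphi(q)=\frac{-2q\log q-(1-2q)\log(1-2q)}{-q\log q-(1-q)\log(1-q)}-1\qquad\text{for } q\in(0,1/2),$$ which is a continuous, monotone decreasing map of $(0,1/2)$ onto $(0,1)$.
   Context: Graphs here are connected and infinite, with finite degree $d$. $G$ is transitive if $\mathrm{Aut}(G)$ acts transitively on $V$. A transitive $G$ is unimodular if $\sum_{v\in V}h(o,v)=\sum_{v\in V}h(v,o)$ for any fixed $o\in V$ and any $h:V\times V\to[0,\infty)$ with $h(\psi(u),\psi(v))=h(u,v)$ for all $\psi\in\mathrm{Aut}(G)$, $u,v\in V$; equivalently, $|\mathrm{Stab}(u)v|=|\mathrm{Stab}(v)u|$ for all $u,v$. A factor-of-IID process with state space $M$ is $X=F(Z)$, where $Z=(Z_v)_{v\in V}$ are independent uniform $[0,1]$ random variables and $F:[0,1]^V\to M^V$ is measurable and $\mathrm{Aut}(G)$-equivariant. A factor-of-IID independent set is a factor-of-IID process with values in $\{0,1\}$ such that $X_u=X_v=1$ cannot happen for neighboring $u,v$; the set is $\{v: X_v=1\}$, and its density is the probability $P(X_v=1)$, which does not depend on $v$. $\partial W$ is the set of edges with exactly one endpoint in $W$; the infimum is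 over nonempty finite $W$. The inverse $\varphi^{-1}$ is extended to $[0,1]\to[0,1/2]$ by $\varphi^{-1}(0)=1/2$ and $\varphi^{-1}(1)=0$. *)

theory Defs
  imports "HOL-Probability.Probability"
begin

section \<open>Unimodular transitive graphs\<close>

text \<open>A graph is an irreflexive symmetric adjacency relation; its vertex set is the whole type.\<close>

definition automorphisms :: "('v \<Rightarrow> 'v \<Rightarrow> bool) \<Rightarrow> ('v \<Rightarrow> 'v) set" where
  "automorphisms E = {\<psi>. bij \<psi> \<and> (\<forall>u v. E (\<psi> u) (\<psi> v) \<longleftrightarrow> E u v)}"

definition vertex_transitive :: "('v \<Rightarrow> 'v \<Rightarrow> bool) \<Rightarrow> bool" where
  "vertex_transitive E \<longleftrightarrow> (\<forall>u v. \<exists>\<psi>\<in>automorphisms E. \<psi> u = v)"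

text \<open>The sums in the mass transport principle are taken in \<open>[0, \<infinity>]\<close>, where they always exist.\<close>

definition unimodular :: "('v \<Rightarrow> 'v \<Rightarrow> bool) \<Rightarrow> bool" where
  "unimodular E \<longleftrightarrow>
     (\<forall>h :: 'v \<Rightarrow> 'v \<Rightarrow> real.
        (\<forall>u v. 0 \<le> h u v) \<and> (\<forall>\<psi>\<in>automorphisms E. \<forall>u v. h (\<psi> u) (\<psi> v) = h u v) \<longrightarrow>
        (\<forall>x. (\<Sum>\<^sub>\<infinity>v\<in>UNIV. ennreal (h x v)) = (\<Sum>\<^sub>\<infinity>v\<in>UNIV. ennreal (h v x))))"

locale unimodular_transitive_graph =
  fixes E :: "'v \<Rightarrow> 'v \<Rightarrow> bool" and d :: nat
  assumes irreflexive: "\<not> E v v"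
    and symmetric: "E u v \<Longrightarrow> E v u"
    and infinite_vertices: "infinite (UNIV :: 'v set)"
    and connected_graph: "E\<^sup>*\<^sup>* u v"
    and finite_neighbours: "finite {u. E v u}"
    and degree: "card {u. E v u} = d"
    and transitive: "vertex_transitive E"
    and unimodular: "unimodular E"

definition edges :: "('v \<Rightarrow> 'v \<Rightarrow> bool) \<Rightarrow> 'v set set" where
  "edges E = {{u, v} | u v. E u v}"

definition edge_boundary :: "('v \<Rightarrow> 'v \<Rightarrow> bool) \<Rightarrow> 'v set \<Rightarrow> 'v set set" where
  "edge_boundary E W = {e \<in> edges E. card (e \<inter> W) = 1}"

definition cheeger_constant :: "('v \<Rightarrow> 'v \<Rightarrow> bool) \<Rightarrow> nat \<Rightarrow> real" where
  "cheeger_constant E d =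
     (INF W\<in>{W. finite W \<and> W \<noteq> {}}. real (card (edge_boundary E W)) / (real d * real (card W)))"

section \<open>Factor-of-IID processes\<close>

definition uniform01 :: "real measure" where
  "uniform01 = restrict_space lborel {0..1}"

text \<open>
  With \<open>\<psi>\<close> ranging over a group, commuting with every precomposition \<open>z \<mapsto> z \<circ> \<psi>\<close> is the same as
  commuting with the left action \<open>z \<mapsto> z \<circ> inv \<psi>\<close>.
\<close>

definition equivariant ::
    "('v \<Rightarrow> 'v \<Rightarrow> bool) \<Rightarrow> (('v \<Rightarrow> real) \<Rightarrow> ('v \<Rightarrow> 'm)) \<Rightarrow> bool" where
  "equivariant E F \<longleftrightarrow>
     (\<forall>\<psi>\<in>automorphisms E. \<forall>z\<in>UNIV \<rightarrow> {0..1}. F (z \<circ> \<psi>) = F z \<circ> \<psi>)"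

definition factor_of_iid ::
    "('v \<Rightarrow> 'v \<Rightarrow> bool) \<Rightarrow> 'm measure \<Rightarrow> 'w measure \<Rightarrow> ('v \<Rightarrow> 'w \<Rightarrow> 'm) \<Rightarrow> bool" where
  "factor_of_iid E M P X \<longleftrightarrow> prob_space P \<and>
     (\<exists>Z F. prob_space.indep_vars P (\<lambda>_. uniform01) Z UNIV \<and>
            (\<forall>v. distr P uniform01 (Z v) = uniform01) \<and>
            F \<in> (\<Pi>\<^sub>M v\<in>UNIV. uniform01) \<rightarrow>\<^sub>M (\<Pi>\<^sub>M v\<in>UNIV. M) \<and>
            equivariant E F \<and>
            (\<forall>\<omega>\<in>space P. \<forall>v. X v \<omega> = F (\<lambda>u. Z u \<omega>) v))"

definition factor_of_iid_independent_set ::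
    "('v \<Rightarrow> 'v \<Rightarrow> bool) \<Rightarrow> 'w measure \<Rightarrow> ('v \<Rightarrow> 'w \<Rightarrow> nat) \<Rightarrow> bool" where
  "factor_of_iid_independent_set E P X \<longleftrightarrow>
     factor_of_iid E (count_space {0, 1}) P X \<and>
     (\<forall>u v. E u v \<longrightarrow> (AE \<omega> in P. \<not> (X u \<omega> = 1 \<and> X v \<omega> = 1)))"

definition density_at :: "'w measure \<Rightarrow> ('v \<Rightarrow> 'w \<Rightarrow> nat) \<Rightarrow> 'v \<Rightarrow> real" where
  "density_at P X v = measure P {\<omega> \<in> space P. X v \<omega> = 1}"

section \<open>The bounding function\<close>

definition phi :: "real \<Rightarrow> real" where
  "phi q = (- 2 * q * ln q - (1 - 2 * q) * ln (1 - 2 * q)) /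
           (- q * ln q - (1 - q) * ln (1 - q)) - 1"

text \<open>The value outside \<open>[0, 1]\<close> is irrelevant.\<close>

definition phi_inv :: "real \<Rightarrow> real" where
  "phi_inv t = (if t = 0 then 1/2 else if t = 1 then 0 else the_inv_into {0<..<1/2} phi t)"

end

theory Submission
  imports Defs "HOL-Real_Asymp.Real_Asymp"
begin

text \<open>
  Write \<open>q\<close> for the density of the independent set, \<open>X v\<close> for the indicator of \<open>v\<close> belonging to it and \<open>H\<close>
  for the Shannon entropy. The main point is the edge-vertex inequality
  \<open>(1 + \<tau>) d H(X x) \<le> (\<Sum>w. H(X x, X w))\<close> for factors of IID processes, where \<open>w\<close> ranges over the
  neighbours of \<open>x\<close>. For an independent set every edge has the joint law \<open>(q, q, 1 - 2q)\<close>; both sides are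
  then explicit, and the inequality becomes \<open>\<tau> \<le> phi q\<close>. Since \<open>phi\<close> is decreasing
  (\<open>phi_has_negative_derivative\<close>), this bounds \<open>q\<close>.

  Suppose first that \<open>X v\<close> depends only on the random variables, called sources, in a finite ball around \<open>v\<close>,
  each of them finitely valued. Expose the sources one after the other. When source \<open>u\<close> is exposed, the
  conditional entropy of \<open>X v\<close> drops by some \<open>a u v \<ge> 0\<close>, and these drops add up to \<open>H(X v)\<close>. The drop
  for a pair \<open>(X v, X w)\<close> is at least \<open>max (a u v) (a u w)\<close>, since conditioning reduces entropy
  (\<open>entropy_submodular\<close>). For a fixed source \<open>u\<close>, the definition of the Cheeger constant, applied to the
  superlevel sets of the function \<open>a u\<close>, shows that the sum of these maxima over ordered adjacent pairs is
  at least \<open>(1 + \<tau>) d\<close> times the sum of \<open>a u\<close> (\<open>sum_max_over_edges_ge\<close>). The mass transport principle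
  converts sums over vertices for a fixed source into sums over sources for a fixed vertex
  (\<open>expansion_of_invariant_weights\<close>), and the edge-vertex inequality follows.

  Mass transport requires that \<open>a u v\<close> be invariant under automorphisms, and so the order of exposure is
  averaged out: \<open>a u v\<close> is the Shapley value of \<open>u\<close> in the game that assigns to a set of sources the entropy
  of \<open>X v\<close> conditioned on them. Only finitely many sources can be ordered at random, but
  this is harmless: by independence, sources outside the ball around \<open>v\<close> are null players
  (\<open>cond_entropy_irrelevant_source\<close>), and null players do not affect the value of the others.

  A general factor is approximated by taking, on each cell of a fine enough discretisation of the variables in
  a large ball, the majority vote (\<open>majority_vote_optimal\<close>, \<open>majority_approximates\<close>). The votes need not
  form an independent set, but the edge-vertex inequality holds for them and passes to the limit.
\<close>

section \<open>The function phi\<close>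

lemma phi_denominator_pos:
  fixes q :: real
  assumes "0 < q" "q < 1"
  shows "0 < - q * ln q - (1 - q) * ln (1 - q)"
proof -
  have "q * ln q < 0" "(1 - q) * ln (1 - q) < 0"
    using assms by (auto intro!: mult_pos_neg)
  then show ?thesis by simp
qed

lemma continuous_on_phi: "continuous_on {0<..<1/2} phi"
proof -
  have "- (q * ln q) - (1 - q) * ln (1 - q) \<noteq> 0" if "0 < q" "q * 2 < 1" for q :: real
    using phi_denominator_pos[of q] that by simp
  then show ?thesis
    unfolding phi_def[abs_def] by (auto intro!: continuous_intros)
qed

text \<open>  With \<open>a = - ln q\<close>, \<open>b = - ln (1 - q)\<close> and \<open>c = - ln (1 - 2 q)\<close>, the quotient rule leaves a
  numerator in which all terms carrying a factor \<open>q\<close> cancel. Its sign is that of \<open>2ab - c(a + b)\<close>,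
  and \<open>c \<ge> 2b\<close> because \<open>1 - 2q \<le> (1 - q)\<^sup>2\<close>.\<close>

lemma phi_has_negative_derivative:
  assumes "0 < q" "q < 1/2"
  shows "\<exists>y. (phi has_real_derivative y) (at q) \<and> y < 0"
proof -
  define a b c where "a = - ln q" and "b = - ln (1 - q)" and "c = - ln (1 - 2 * q)"
  define n where "n = - 2 * q * ln q - (1 - 2 * q) * ln (1 - 2 * q)"
  define m where "m = - q * ln q - (1 - q) * ln (1 - q)"
  have m: "m > 0"
    unfolding m_def using phi_denominator_pos[of q] assms by simp
  have xlnx: "((\<lambda>x. x * ln x) has_real_derivative ln x + 1) (at x)" if "x > 0" for x :: real
    using that by (auto intro!: derivative_eq_intros)
  have "((\<lambda>q. (1 - 2 * q) * ln (1 - 2 * q)) has_real_derivative (ln (1 - 2 * q) + 1) * (- 2)) (at q)"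
    by (rule DERIV_chain2[OF xlnx]) (use assms in \<open>auto intro!: derivative_eq_intros\<close>)
  from DERIV_diff[OF DERIV_cmult[OF xlnx[OF \<open>0 < q\<close>], of "- 2"] this]
  have nd: "((\<lambda>q. - 2 * q * ln q - (1 - 2 * q) * ln (1 - 2 * q)) has_real_derivative 2 * (a - c)) (at q)"
    by (simp add: a_def c_def mult.assoc mult.commute[of "ln (1 - 2 * q)" 2])
  have "((\<lambda>q. (1 - q) * ln (1 - q)) has_real_derivative (ln (1 - q) + 1) * (- 1)) (at q)"
    by (rule DERIV_chain2[OF xlnx]) (use assms in \<open>auto intro!: derivative_eq_intros\<close>)
  from DERIV_diff[OF DERIV_cmult[OF xlnx[OF \<open>0 < q\<close>], of "- 1"] this]
  have md: "((\<lambda>q. - q * ln q - (1 - q) * ln (1 - q)) has_real_derivative a - b) (at q)"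
    by (simp add: a_def b_def)
  have deriv: "(phi has_real_derivative (2 * (a - c) * m - n * (a - b)) / (m * m)) (at q)"
    unfolding phi_def[abs_def]
    using DERIV_diff[OF DERIV_divide[OF nd md] DERIV_const[of 1]] m
    unfolding m_def[symmetric] n_def[symmetric] by simp
  have "a > 0" "b > 0"
    using assms by (auto simp: a_def b_def)
  have "2 * b \<le> c"
  proof -
    have "1 - 2 * q \<le> (1 - q) ^ 2" by (simp add: power2_eq_square algebra_simps)
    then have "ln (1 - 2 * q) \<le> ln ((1 - q) ^ 2)"
      using assms by (intro ln_mono) auto
    also have "\<dots> = 2 * ln (1 - q)"
      using assms by (simp add: ln_realpow)
    finally show ?thesis by (simp add: b_def c_def)
  qed
  have "2 * (a - c) * m - n * (a - b) = 2 * a * b - c * (a + b)"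
    unfolding m_def n_def a_def b_def c_def by (simp add: algebra_simps)
  also have "\<dots> < 0"
  proof -
    have "2 * b * (a + b) \<le> c * (a + b)"
      using \<open>2 * b \<le> c\<close> \<open>a > 0\<close> \<open>b > 0\<close> by (intro mult_right_mono) auto
    moreover have "0 < b * b" using \<open>b > 0\<close> by simp
    ultimately show ?thesis by (simp add: algebra_simps)
  qed
  finally show ?thesis
    using deriv m by (intro exI conjI) (auto intro!: divide_neg_pos)
qed

lemma phi_less:
  assumes "0 < p" "p < q" "q < 1/2"
  shows "phi q < phi p"
  using assms by (intro DERIV_neg_imp_decreasing[OF \<open>p < q\<close>] phi_has_negative_derivative) auto

lemma phi_at_0: "(phi \<longlongrightarrow> 1) (at_right 0)"
  unfolding phi_def[abs_def] by real_asymp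

lemma phi_at_half: "(phi \<longlongrightarrow> 0) (at_left (1/2))"
proof -
  have "((\<lambda>q. - (q * ln q) - (1 - q) * ln (1 - q)) \<longlongrightarrow> - ln (1/2)) (at_left (1/2::real))"
    by real_asymp
  moreover have "((\<lambda>q. - 2 * q * ln q - (1 - 2 * q) * ln (1 - 2 * q)) \<longlongrightarrow> - ln (1/2)) (at_left (1/2::real))"
    by real_asymp
  ultimately have "((\<lambda>q. (- 2 * q * ln q - (1 - 2 * q) * ln (1 - 2 * q)) / 
       (- (q * ln q) - (1 - q) * ln (1 - q)) - 1) \<longlongrightarrow> (- ln (1/2)) / (- ln (1/2)) - 1) (at_left (1/2::real))"
    by (intro tendsto_intros) auto
  then show ?thesis unfolding phi_def[abs_def] by simp
qed

lemma phi_bounds: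
  assumes "0 < q" "q < 1/2"
  shows "0 < phi q" "phi q < 1"
proof -
  have "phi (q/2) \<le> 1"
  proof (rule tendsto_lowerbound[OF phi_at_0])
    show "\<forall>\<^sub>F x in at_right 0. phi (q/2) \<le> phi x"
      unfolding eventually_at_right_field using assms
      by (intro exI[of _ "q/2"]) (auto intro!: less_imp_le phi_less)
  qed simp
  then show "phi q < 1"
    using phi_less[of "q/2" q] assms by simp
  define r where "r = (q + 1/2) / 2"
  have r: "q < r" "r < 1/2" using assms by (auto simp: r_def)
  have "0 \<le> phi r"
  proof (rule tendsto_upperbound[OF phi_at_half])
    show "\<forall>\<^sub>F x in at_left (1/2). phi x \<le> phi r"
      unfolding eventually_at_left_field using assms r
      by (intro exI[of _ r]) (auto intro!: less_imp_le phi_less)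
  qed simp
  then show "0 < phi q"
    using phi_less[of q r] assms r by simp
qed

lemma phi_image: "phi ` {0<..<1/2} = {0<..<1}"
proof
  show "phi ` {0<..<1/2} \<subseteq> {0<..<1}" using phi_bounds by auto
  show "{0<..<1} \<subseteq> phi ` {0<..<1/2}"
  proof
    fix y :: real assume y: "y \<in> {0<..<1}"
    have "\<forall>\<^sub>F x in at_right 0. y < phi x \<and> x \<in> {0<..<1/2}"
      using y order_tendstoD(1)[OF phi_at_0, of y] 
      by (intro eventually_conj eventually_at_right_real) auto
    then obtain p where p: "y < phi p" "0 < p" "p < 1/2"
      using eventually_happens by force
    have "\<forall>\<^sub>F x in at_left (1/2). phi x < y \<and> x \<in> {0<..<1/2}"
      using y order_tendstoD(2)[OF phi_at_half, of y] 
      by (intro eventually_conj eventually_at_left_real) auto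
    then obtain q where q: "phi q < y" "0 < q" "q < 1/2"
      using eventually_happens by force
    have "{phi q..phi p} \<subseteq> phi ` {0<..<1/2}"
      using p q continuous_on_phi by (intro connected_contains_Icc connected_continuous_image) auto
    then show "y \<in> phi ` {0<..<1/2}" using p q by auto
  qed
qed

text \<open>  The inequality \<open>t \<le> phi q\<close> carries information only for \<open>0 < q < 1/2\<close>; at \<open>q = 1/2\<close>, where
  \<open>phi\<close> has the limit \<open>0\<close>, it is replaced by \<open>t = 0\<close>.\<close>

lemma le_phi_inv:
  assumes "0 \<le> q" "q \<le> 1/2" "0 \<le> t" "t \<le> 1"
    and zero: "q = 1/2 \<Longrightarrow> t = 0"
    and le: "0 < q \<Longrightarrow> q < 1/2 \<Longrightarrow> t \<le> phi q"
  shows "q \<le> phi_inv t"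
proof -
  consider "t = 0" | "t = 1" | "0 < t" "t < 1" using assms by linarith
  then show ?thesis
  proof cases
    case 1
    then show ?thesis using assms by (simp add: phi_inv_def)
  next
    case 2
    then have "q = 0" using assms phi_bounds[of q] by fastforce
    then show ?thesis using 2 by (simp add: phi_inv_def)
  next
    case 3
    have inj: "inj_on phi {0<..<1/2}"
      using phi_less by (intro linorder_inj_onI) (auto, fastforce)
    have "t \<in> phi ` {0<..<1/2}" using 3 phi_image by auto
    then have p: "phi_inv t \<in> {0<..<1/2}" "phi (phi_inv t) = t"
      using 3 the_inv_into_into[OF inj _ subset_refl] f_the_inv_into_f[OF inj]
      unfolding phi_inv_def by auto
    show ?thesis
    proof (rule ccontr)
      assume "\<not> ?thesis"
      then have "phi q < t" "0 < q" "q < 1/2"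
        using p phi_less[of "phi_inv t" q] assms zero 3 by (auto simp: less_le)
      then show False using le by simp
    qed
  qed
qed

section \<open>Shannon entropy of simple functions\<close>

context information_space
begin

lemma entropy_cong:
  assumes "\<And>\<omega>. \<omega> \<in> space M \<Longrightarrow> X \<omega> = Y \<omega>"
  shows "\<H>(X) = \<H>(Y)"
proof -
  have img: "X ` space M = Y ` space M" using assms by (intro image_cong) auto
  show ?thesis
    unfolding entropy_def img using distr_cong[OF refl refl, of M X Y] assms by metis
qed

lemma entropy_mono:
  assumes "simple_function M Y" "\<And>\<omega>. \<omega> \<in> space M \<Longrightarrow> X \<omega> = f (Y \<omega>)"
  shows "\<H>(X) \<le> \<H>(Y)"
  using entropy_data_processing[OF assms(1), of f] entropy_cong[of X "f \<circ> Y"] assms(2) by simp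

lemma entropy_eq_of_mutual_functions:
  assumes "simple_function M X" "simple_function M Y"
    and "\<And>\<omega>. \<omega> \<in> space M \<Longrightarrow> X \<omega> = f (Y \<omega>)" "\<And>\<omega>. \<omega> \<in> space M \<Longrightarrow> Y \<omega> = g (X \<omega>)"
  shows "\<H>(X) = \<H>(Y)"
  using entropy_mono[OF assms(1), where f = g, OF assms(4)] entropy_mono[OF assms(2), where f = f, OF assms(3)]
  by (rule antisym[rotated])

lemma expectation_simple_function:
  fixes g :: "'c \<Rightarrow> real"
  assumes "simple_function M X"
  shows "(\<Sum>x\<in>X ` space M. prob (X -` {x} \<inter> space M) * g x) = (\<integral>\<omega>. g (X \<omega>) \<partial>M)"
proof -
  have sg: "simple_function M (\<lambda>\<omega>. g (X \<omega>))"
    using simple_function_compose[OF assms, of g] by (simp add: comp_def)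
  have fin: "finite (X ` space M)" using assms by (rule simple_functionD)
  have "(\<integral>\<omega>. g (X \<omega>) \<partial>M) = (\<integral>\<omega>. (\<Sum>x\<in>X ` space M. indicator (X -` {x} \<inter> space M) \<omega> * g x) \<partial>M)"
  proof (rule Bochner_Integration.integral_cong[OF refl])
    fix \<omega> assume w: "\<omega> \<in> space M"
    have "(\<Sum>x\<in>X ` space M. indicator (X -` {x} \<inter> space M) \<omega> * g x) 
        = (\<Sum>x\<in>X ` space M. if x = X \<omega> then g x else 0)"
      using w by (intro sum.cong) (auto simp: indicator_def)
    then show "g (X \<omega>) = (\<Sum>x\<in>X ` space M. indicator (X -` {x} \<inter> space M) \<omega> * g x)"
      using w fin by simp
  qed
  also have "\<dots> = (\<Sum>x\<in>X ` space M. \<integral>\<omega>. indicator (X -` {x} \<inter> space M) \<omega> * g x \<partial>M)"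
    using simple_functionD(2)[OF assms]
    by (intro Bochner_Integration.integral_sum integrable_mult_left integrable_real_indicator)
       (auto simp: emeasure_eq_measure)
  also have "\<dots> = (\<Sum>x\<in>X ` space M. prob (X -` {x} \<inter> space M) * g x)"
    using simple_functionD(2)[OF assms] by (intro sum.cong) auto
  finally show ?thesis ..
qed

text \<open>  \<open>own_prob X \<omega>\<close> is the probability of the value that \<open>X\<close> takes at \<open>\<omega>\<close>, so the entropy of \<open>X\<close> is
  the expectation of \<open>- log (own_prob X)\<close>. In this form the entropies of several variables are
  integrals over one space, and no sum over joint values has to be split into marginals.\<close>

definition own_prob :: "('a \<Rightarrow> 'c) \<Rightarrow> 'a \<Rightarrow> real" where
  "own_prob X \<omega> = prob (X -` {X \<omega>} \<inter> space M)"

lemma entropy_eq_expectation: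
  assumes "simple_function M X"
  shows "\<H>(X) = (\<integral>\<omega>. - log b (own_prob X \<omega>) \<partial>M)"
  unfolding own_prob_def 
  using entropy_simple_distributed[OF simple_distributedI[OF assms measure_nonneg refl]]
    expectation_simple_function[OF assms, of "\<lambda>x. log b (prob (X -` {x} \<inter> space M))"] by simp

lemma AE_own_prob_pos:
  assumes "simple_function M X"
  shows "AE \<omega> in M. 0 < own_prob X \<omega>"
proof -
  have "AE \<omega> in M. \<forall>x\<in>{x\<in>X ` space M. prob (X -` {x} \<inter> space M) = 0}. \<omega> \<notin> X -` {x} \<inter> space M"
  proof (rule AE_finite_allI)
    show "finite {x\<in>X ` space M. prob (X -` {x} \<inter> space M) = 0}"
      using assms by (auto dest: simple_functionD)
    fix x assume "x \<in> {x\<in>X ` space M. prob (X -` {x} \<inter> space M) = 0}"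
    then show "AE \<omega> in M. \<omega> \<notin> X -` {x} \<inter> space M"
      using simple_functionD(2)[OF assms, of "{x}"]
      by (intro AE_not_in) (auto simp: null_sets_def emeasure_eq_measure)
  qed
  then show ?thesis
    by (rule AE_mp) (auto intro!: AE_I2 simp: own_prob_def zero_less_measure_iff)
qed

lemma integrable_log_own_prob:
  assumes "simple_function M X"
  shows "integrable M (\<lambda>\<omega>. log b (own_prob X \<omega>))"
proof (rule integrable_simple_function)
  show "simple_function M (\<lambda>\<omega>. log b (own_prob X \<omega>))"
    unfolding own_prob_def
    using simple_function_compose[OF assms, of "\<lambda>x. log b (prob (X -` {x} \<inter> space M))"]
    by (simp add: comp_def)
qed (simp add: emeasure_eq_measure)

text \<open>  The difference of the two sides is the conditional mutual information of \<open>X\<close> and \<open>Y\<close> given \<open>Z\<close>.\<close>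

lemma entropy_submodular:
  assumes X: "simple_function M X" and Y: "simple_function M Y" and Z: "simple_function M Z"
  shows "\<H>(\<lambda>\<omega>. (X \<omega>, Y \<omega>, Z \<omega>)) + \<H>(Z) \<le> \<H>(\<lambda>\<omega>. (X \<omega>, Z \<omega>)) + \<H>(\<lambda>\<omega>. (Y \<omega>, Z \<omega>))"
proof -
  note YZ = simple_function_Pair[OF Y Z] and XZ = simple_function_Pair[OF X Z]
  note XYZ = simple_function_Pair[OF X YZ]
  let ?p = "\<lambda>X x. prob (X -` {x} \<inter> space M)"
  let ?g = "\<lambda>(x, y, z). log b (?p (\<lambda>x. (X x, Y x, Z x)) (x, y, z) / 
      (?p (\<lambda>x. (X x, Z x)) (x, z) * (?p (\<lambda>x. (Y x, Z x)) (y,z) / ?p Z z)))"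
  have "0 \<le> \<I>(X ; Y | Z)" by (rule conditional_mutual_information_nonneg[OF X Y Z])
  also have "\<I>(X ; Y | Z) = (\<Sum>u\<in>(\<lambda>x. (X x, Y x, Z x)) ` space M. ?p (\<lambda>x. (X x, Y x, Z x)) u * ?g u)"
    by (subst conditional_mutual_information_eq[OF simple_distributedI[OF Z measure_nonneg refl]
        simple_distributedI[OF YZ measure_nonneg refl] simple_distributedI[OF XZ measure_nonneg refl]
        simple_distributedI[OF XYZ measure_nonneg refl]]) (auto intro!: sum.cong)
  also have "\<dots> = (\<integral>\<omega>. log b (own_prob (\<lambda>x. (X x, Y x, Z x)) \<omega> / 
      (own_prob (\<lambda>x. (X x, Z x)) \<omega> * (own_prob (\<lambda>x. (Y x, Z x)) \<omega> / own_prob Z \<omega>))) \<partial>M)"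
    by (subst expectation_simple_function[OF XYZ]) (simp add: own_prob_def)
  also have "\<dots> = (\<integral>\<omega>. log b (own_prob (\<lambda>x. (X x, Y x, Z x)) \<omega>) + log b (own_prob Z \<omega>)
      - (log b (own_prob (\<lambda>x. (X x, Z x)) \<omega>) + log b (own_prob (\<lambda>x. (Y x, Z x)) \<omega>)) \<partial>M)"
  proof (rule integral_cong_AE)
    show "AE \<omega> in M. log b (own_prob (\<lambda>x. (X x, Y x, Z x)) \<omega> / 
        (own_prob (\<lambda>x. (X x, Z x)) \<omega> * (own_prob (\<lambda>x. (Y x, Z x)) \<omega> / own_prob Z \<omega>)))
      = log b (own_prob (\<lambda>x. (X x, Y x, Z x)) \<omega>) + log b (own_prob Z \<omega>)
        - (log b (own_prob (\<lambda>x. (X x, Z x)) \<omega>) + log b (own_prob (\<lambda>x. (Y x, Z x)) \<omega>))"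
      using AE_own_prob_pos[OF XYZ] AE_own_prob_pos[OF YZ] AE_own_prob_pos[OF XZ] AE_own_prob_pos[OF Z]
      by eventually_elim (simp add: log_divide log_mult)
    show "(\<lambda>\<omega>. log b (own_prob (\<lambda>x. (X x, Y x, Z x)) \<omega> / 
        (own_prob (\<lambda>x. (X x, Z x)) \<omega> * (own_prob (\<lambda>x. (Y x, Z x)) \<omega> / own_prob Z \<omega>)))) \<in> borel_measurable M"
      using simple_function_compose[OF XYZ, of ?g]
      by (intro borel_measurable_simple_function) (simp add: comp_def own_prob_def)
  qed (use integrable_log_own_prob[OF XYZ] integrable_log_own_prob[OF YZ] integrable_log_own_prob[OF XZ] 
        integrable_log_own_prob[OF Z] in auto)
  also have "\<dots> = - \<H>(\<lambda>\<omega>. (X \<omega>, Y \<omega>, Z \<omega>)) - \<H>(Z) + (\<H>(\<lambda>\<omega>. (X \<omega>, Z \<omega>)) + \<H>(\<lambda>\<omega>. (Y \<omega>, Z \<omega>)))"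
    using integrable_log_own_prob[OF XYZ] integrable_log_own_prob[OF YZ] integrable_log_own_prob[OF XZ] 
        integrable_log_own_prob[OF Z]
    by (simp add: entropy_eq_expectation[OF XYZ] entropy_eq_expectation[OF YZ] entropy_eq_expectation[OF XZ]
        entropy_eq_expectation[OF Z])
  finally show ?thesis by simp
qed

lemma entropy_indep_pair:
  assumes X: "simple_function M X" and Y: "simple_function M Y"
    and "indep_var (count_space (X ` space M)) X (count_space (Y ` space M)) Y"
  shows "\<H>(\<lambda>\<omega>. (X \<omega>, Y \<omega>)) = \<H>(X) + \<H>(Y)"
proof -
  have "\<I>(X ; Y) = 0"
    using assms(3) mutual_information_indep_vars by blast
  then have "\<H>(\<lambda>\<omega>. (Y \<omega>, X \<omega>)) = \<H>(X) + \<H>(Y)"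
    using entropy_chain_rule[OF Y X] mutual_information_eq_entropy_conditional_entropy[OF X Y] by simp
  moreover have "\<H>(\<lambda>\<omega>. (X \<omega>, Y \<omega>)) = \<H>(\<lambda>\<omega>. (Y \<omega>, X \<omega>))"
    by (rule entropy_eq_of_mutual_functions[where f = prod.swap and g = prod.swap])
       (auto intro: simple_function_Pair X Y)
  ultimately show ?thesis by simp
qed

lemma entropy_comp_measure_preserving:
  assumes T: "T \<in> M \<rightarrow>\<^sub>M M" "distr M M T = M" "T ` space M = space M" and X: "simple_function M X"
  shows "\<H>(X \<circ> T) = \<H>(X)"
proof -
  have "(X \<circ> T) ` space M = X ` space M" using T(3) by (metis image_comp)
  moreover have "X \<in> M \<rightarrow>\<^sub>M count_space (X ` space M)"
    using X by (auto simp: simple_function_def measurable_count_space_eq2)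
  then have "distr M (count_space (X ` space M)) (X \<circ> T) = distr M (count_space (X ` space M)) X"
    using T by (subst distr_distr[symmetric]) auto
  ultimately show ?thesis unfolding entropy_def by simp
qed

end

section \<open>Shapley values\<close>

text \<open>  A game assigns a real \<open>k S\<close> to each set \<open>S\<close> of players. If the players of a finite set \<open>B\<close> enter
  one after the other in a uniformly random order, \<open>shapley_weight s n\<close> is the probability that a given
  player finds exactly a given set of \<open>s\<close> others already present, and \<open>shapley k B u\<close> is the expected drop of
  \<open>k\<close> at the entrance of \<open>u\<close>. Drops are counted positively because \<open>k\<close> will be a conditional
  entropy, which decreases as more is known.\<close>

definition shapley_weight :: "nat \<Rightarrow> nat \<Rightarrow> real" where
  "shapley_weight s n = fact s * fact (n - 1 - s) / fact n"

definition shapley :: "('v set \<Rightarrow> real) \<Rightarrow> 'v set \<Rightarrow> 'v \<Rightarrow> real" where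
  "shapley k B u = (\<Sum>S\<in>Pow (B - {u}). shapley_weight (card S) (card B) * (k S - k (insert u S)))"

lemma shapley_weight_nonneg: "0 \<le> shapley_weight s n"
  by (simp add: shapley_weight_def)

lemma shapley_weight_pascal:
  assumes "s < n"
  shows "shapley_weight s (Suc n) + shapley_weight (Suc s) (Suc n) = shapley_weight s n"
proof -
  obtain m where n: "n = Suc (s + m)" using assms less_imp_Suc_add by blast
  show ?thesis
    unfolding shapley_weight_def n by (simp add: divide_simps) (simp add: algebra_simps)
qed

lemma shapley_mono:
  assumes "\<And>S. S \<subseteq> B - {u} \<Longrightarrow> k S - k (insert u S) \<le> l S - l (insert u S)"
  shows "shapley k B u \<le> shapley l B u"
  unfolding shapley_def using assms shapley_weight_nonneg
  by (intro sum_mono mult_left_mono) auto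

lemma shapley_nonneg:
  assumes "\<And>S. S \<subseteq> B - {u} \<Longrightarrow> k (insert u S) \<le> k S"
  shows "0 \<le> shapley k B u"
  unfolding shapley_def using assms shapley_weight_nonneg
  by (intro sum_nonneg mult_nonneg_nonneg) auto

text \<open>  For every order of entrance the drops telescope. In terms of weights: the coefficients of \<open>k S\<close> cancel
  unless \<open>S\<close> is empty or all of \<open>B\<close>.\<close>

lemma shapley_efficient:
  assumes "finite B"
  shows "(\<Sum>u\<in>B. shapley k B u) = k {} - k B"
proof (cases "B = {}")
  case True
  then show ?thesis by simp
next
  case False
  define n where "n = card B"
  have n: "n > 0" using False assms by (simp add: n_def card_gt_0_iff)
  have fin[simp]: "finite S" if "S \<subseteq> B" for S using that assms finite_subset by auto
  \<comment> \<open>\<open>k S\<close> is counted positively by the players outside \<open>S\<close>, who enter next, and negatively by those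
    inside, one of whom entered last.\<close>
  have gain: "(\<Sum>u\<in>B. \<Sum>S\<in>Pow (B - {u}). shapley_weight (card S) n * k S)
      = (\<Sum>S\<in>Pow B. real (n - card S) * shapley_weight (card S) n * k S)"
  proof -
    have "(\<Sum>u\<in>B. \<Sum>S\<in>Pow (B - {u}). shapley_weight (card S) n * k S)
        = (\<Sum>u\<in>B. \<Sum>S\<in>{S\<in>Pow B. u \<notin> S}. shapley_weight (card S) n * k S)"
      by (intro sum.cong refl) auto
    also have "\<dots> = (\<Sum>S\<in>Pow B. \<Sum>u\<in>{u\<in>B. u \<notin> S}. shapley_weight (card S) n * k S)"
      using assms by (intro sum.swap_restrict) auto
    also have "\<dots> = (\<Sum>S\<in>Pow B. real (n - card S) * shapley_weight (card S) n * k S)"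
    proof (rule sum.cong[OF refl])
      fix S assume "S \<in> Pow B"
      moreover have "{u \<in> B. u \<notin> S} = B - S" by auto
      ultimately show "(\<Sum>u\<in>{u\<in>B. u \<notin> S}. shapley_weight (card S) n * k S) =
          real (n - card S) * shapley_weight (card S) n * k S"
        by (simp add: card_Diff_subset n_def)
    qed
    finally show ?thesis .
  qed
  have loss: "(\<Sum>u\<in>B. \<Sum>S\<in>Pow (B - {u}). shapley_weight (card S) n * k (insert u S))
      = (\<Sum>S\<in>Pow B. real (card S) * shapley_weight (card S - 1) n * k S)"
  proof -
    have "(\<Sum>u\<in>B. \<Sum>S\<in>Pow (B - {u}). shapley_weight (card S) n * k (insert u S))
        = (\<Sum>u\<in>B. \<Sum>S\<in>{S\<in>Pow B. u \<in> S}. shapley_weight (card S - 1) n * k S)"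
    proof (rule sum.cong[OF refl])
      fix u assume "u \<in> B"
      then show "(\<Sum>S\<in>Pow (B - {u}). shapley_weight (card S) n * k (insert u S)) =
          (\<Sum>S\<in>{S\<in>Pow B. u \<in> S}. shapley_weight (card S - 1) n * k S)"
      proof (intro sum.reindex_bij_witness[where i = "\<lambda>S. S - {u}" and j = "insert u"])
        fix S assume "S \<in> Pow (B - {u})"
        then have "finite S" "u \<notin> S" by (auto intro: fin)
        then show "shapley_weight (card (insert u S) - 1) n * k (insert u S) = shapley_weight (card S) n * k (insert u S)"
          by simp
      qed (use \<open>u \<in> B\<close> in auto)
    qed
    also have "\<dots> = (\<Sum>S\<in>Pow B. \<Sum>u\<in>{u\<in>B. u \<in> S}. shapley_weight (card S - 1) n * k S)"
      using assms by (intro sum.swap_restrict) auto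
    also have "\<dots> = (\<Sum>S\<in>Pow B. real (card S) * shapley_weight (card S - 1) n * k S)"
    proof (rule sum.cong[OF refl])
      fix S assume "S \<in> Pow B"
      then have "{u \<in> B. u \<in> S} = S" by auto
      then show "(\<Sum>u\<in>{u\<in>B. u \<in> S}. shapley_weight (card S - 1) n * k S) =
          real (card S) * shapley_weight (card S - 1) n * k S"
        by simp
    qed
    finally show ?thesis .
  qed
  have coeff: "real (n - s) * shapley_weight s n - real s * shapley_weight (s - 1) n
      = (if s = 0 then 1 else if s = n then -1 else 0)" if "s \<le> n" for s
  proof -
    have f: "real m * fact (m - 1) = fact m" if "m > 0" for m
      using that by (simp add: fact_reduce)
    consider "s = 0" | "s = n" "s \<noteq> 0" | "0 < s" "s < n" using \<open>s \<le> n\<close> by linarith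
    then show ?thesis
    proof cases
      case 1
      then show ?thesis using n f[of n] by (simp add: shapley_weight_def)
    next
      case 2
      then show ?thesis using n f[of n] by (simp add: shapley_weight_def)
    next
      case 3
      have "n - 1 - s = n - s - 1" "n - 1 - (s - 1) = n - s" using 3 by auto
      then have "real (n - s) * shapley_weight s n = fact s * (real (n - s) * fact (n - s - 1)) / fact n"
        "real s * shapley_weight (s - 1) n = (real s * fact (s - 1)) * fact (n - s) / fact n"
        unfolding shapley_weight_def by (simp_all only: times_divide_eq_right mult_ac)
      then have "real (n - s) * shapley_weight s n = fact s * fact (n - s) / fact n"
        "real s * shapley_weight (s - 1) n = fact s * fact (n - s) / fact n"
        using 3 f[of "n - s"] f[of s] by simp_all
      then show ?thesis using 3 by simp
    qed
  qed
  have "(\<Sum>u\<in>B. shapley k B u) =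
      (\<Sum>S\<in>Pow B. (real (n - card S) * shapley_weight (card S) n - real (card S) * shapley_weight (card S - 1) n) * k S)"
    unfolding shapley_def n_def[symmetric]
    by (simp add: right_diff_distrib left_diff_distrib sum_subtractf gain loss del: of_nat_diff)
  also have "\<dots> = (\<Sum>S\<in>Pow B. (if S = {} then k {} else 0) - (if S = B then k B else 0))"
  proof (rule sum.cong[OF refl])
    fix S assume S: "S \<in> Pow B"
    then have "card S \<le> n" "card S = 0 \<longleftrightarrow> S = {}"
      using assms by (auto simp: n_def card_mono)
    moreover have "card S = n \<longleftrightarrow> S = B"
      using S card_subset_eq[OF assms, of S] by (auto simp: n_def)
    ultimately show "(real (n - card S) * shapley_weight (card S) n - real (card S) * shapley_weight (card S - 1) n) * k S
       = (if S = {} then k {} else 0) - (if S = B then k B else 0)"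
      using coeff[of "card S"] False n by auto
  qed
  also have "\<dots> = k {} - k B"
    using assms by (simp add: sum_subtractf)
  finally show ?thesis .
qed

text \<open>  Deleting a player from a uniformly random order leaves a uniformly random order of the others, which is
  the identity of \<open>shapley_weight_pascal\<close>; so a player who never changes \<open>k\<close> does not affect the value
  of the others. This makes the value of \<open>u\<close> meaningful in an infinite set of players, all but finitely
  many of which are null players.\<close>

lemma shapley_insert_null_player:
  assumes "finite B" "x \<notin> B" "u \<in> B"
    and null: "\<And>S. S \<subseteq> B \<Longrightarrow> k (insert x S) = k S"
  shows "shapley k (insert x B) u = shapley k B u"
proof -
  define n where "n = card B"
  let ?m = "\<lambda>S. k S - k (insert u S)"
  have "insert x B - {u} = insert x (B - {u})" using assms by auto
  then have split: "Pow (insert x B - {u}) = Pow (B - {u}) \<union> insert x ` Pow (B - {u})"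
    by (simp add: Pow_insert)
  have inj: "inj_on (insert x) (Pow (B - {u}))"
    using assms by (intro inj_onI) (metis Diff_subset PowD insert_ident subsetD)
  have "shapley k (insert x B) u = (\<Sum>S\<in>Pow (B - {u}). shapley_weight (card S) (Suc n) * ?m S)
      + (\<Sum>S\<in>insert x ` Pow (B - {u}). shapley_weight (card S) (Suc n) * ?m S)"
    unfolding shapley_def split n_def using assms by (subst sum.union_disjoint) auto
  also have "(\<Sum>S\<in>insert x ` Pow (B - {u}). shapley_weight (card S) (Suc n) * ?m S)
      = (\<Sum>S\<in>Pow (B - {u}). shapley_weight (Suc (card S)) (Suc n) * ?m S)"
  proof (subst sum.reindex[OF inj], rule sum.cong[OF refl])
    fix S assume S: "S \<in> Pow (B - {u})"
    then have "finite S" "x \<notin> S" "S \<subseteq> B" "insert u S \<subseteq> B"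
      using assms finite_subset[of S B] by auto
    then show "((\<lambda>S. shapley_weight (card S) (Suc n) * ?m S) \<circ> insert x) S = shapley_weight (Suc (card S)) (Suc n) * ?m S"
      using null[of S] null[of "insert u S"] by (simp add: insert_commute)
  qed
  also have "(\<Sum>S\<in>Pow (B - {u}). shapley_weight (card S) (Suc n) * ?m S) + \<dots>
      = (\<Sum>S\<in>Pow (B - {u}). shapley_weight (card S) n * ?m S)"
    unfolding sum.distrib[symmetric] distrib_right[symmetric]
  proof (rule sum.cong[OF refl])
    fix S assume "S \<in> Pow (B - {u})"
    then have "card S < n" unfolding n_def using assms by (intro psubset_card_mono) auto
    then show "(shapley_weight (card S) (Suc n) + shapley_weight (Suc (card S)) (Suc n)) * ?m S = shapley_weight (card S) n * ?m S"
      by (simp add: shapley_weight_pascal)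
  qed
  finally show ?thesis by (simp add: shapley_def n_def)
qed

lemma shapley_union_null_players:
  assumes "finite C" "finite B" "u \<in> B"
    and null: "\<And>x S. x \<notin> B \<Longrightarrow> finite S \<Longrightarrow> k (insert x S) = k S"
  shows "shapley k (B \<union> C) u = shapley k B u"
  using assms(1)
proof (induction C)
  case (insert x C)
  show ?case
  proof (cases "x \<in> B \<union> C")
    case True
    then show ?thesis using insert.IH by (simp add: insert_absorb)
  next
    case False
    then have "shapley k (insert x (B \<union> C)) u = shapley k (B \<union> C) u"
      using assms insert.hyps
      by (intro shapley_insert_null_player null) (auto intro: finite_subset)
    then show ?thesis using insert.IH by simp
  qed
qed simp

lemma shapley_null_player:
  assumes "finite B" and "\<And>S. finite S \<Longrightarrow> k (insert u S) = k S"
  shows "shapley k B u = 0"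
  unfolding shapley_def using assms by (intro sum.neutral) (auto dest: finite_subset)

lemma shapley_image:
  assumes "inj f" "\<And>S. S \<subseteq> insert u B \<Longrightarrow> k (f ` S) = l S"
  shows "shapley k (f ` B) (f u) = shapley l B u"
proof -
  have "f ` B - {f u} = f ` (B - {u})" using assms(1) by (auto dest: injD)
  then have Pow: "Pow (f ` B - {f u}) = image f ` Pow (B - {u})"
    by (simp add: image_Pow_surj)
  have inj: "inj_on (image f) (Pow (B - {u}))"
    using assms(1) by (intro inj_onI) (simp add: inj_image_eq_iff)
  show ?thesis
    unfolding shapley_def Pow
  proof (subst sum.reindex[OF inj], rule sum.cong[OF refl])
    fix S assume "S \<in> Pow (B - {u})"
    then have "k (f ` S) = l S" "k (insert (f u) (f ` S)) = l (insert u S)"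
      using assms(2)[of S] assms(2)[of "insert u S"] by auto
    then show "((\<lambda>S. shapley_weight (card S) (card (f ` B)) * (k S - k (insert (f u) S))) \<circ> image f) S 
      = shapley_weight (card S) (card B) * (l S - l (insert u S))"
      using assms(1) by (simp add: card_image inj_on_subset)
  qed
qed

section \<open>Mass transport and expansion\<close>

definition graph_ball :: "('v \<Rightarrow> 'v \<Rightarrow> bool) \<Rightarrow> nat \<Rightarrow> 'v \<Rightarrow> 'v set" where
  "graph_ball E n v = {w. \<exists>k\<le>n. (E ^^ k) v w}"

lemma relpowp_automorphism:
  assumes "\<psi> \<in> automorphisms E"
  shows "(E ^^ k) (\<psi> v) (\<psi> w) \<longleftrightarrow> (E ^^ k) v w"
proof (induction k arbitrary: w)
  case 0
  then show ?case using assms by (auto simp: automorphisms_def bij_def inj_def)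
next
  case (Suc k)
  have "surj \<psi>" and E: "E (\<psi> x) (\<psi> y) \<longleftrightarrow> E x y" for x y
    using assms by (auto simp: automorphisms_def bij_def)
  have "(E ^^ Suc k) (\<psi> v) (\<psi> w) \<longleftrightarrow> (\<exists>y. (E ^^ k) (\<psi> v) (\<psi> y) \<and> E (\<psi> y) (\<psi> w))"
    using \<open>surj \<psi>\<close> by (metis relpowp_Suc_E relpowp_Suc_I surj_def)
  also have "\<dots> \<longleftrightarrow> (E ^^ Suc k) v w"
    using Suc E by auto
  finally show ?case .
qed

lemma graph_ball_automorphism:
  assumes "\<psi> \<in> automorphisms E"
  shows "graph_ball E n (\<psi> v) = \<psi> ` graph_ball E n v"
proof -
  have "surj \<psi>" using assms by (auto simp: automorphisms_def bij_def)
  then have "graph_ball E n (\<psi> v) = \<psi> ` {w. \<psi> w \<in> graph_ball E n (\<psi> v)}"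
    by (simp add: surj_image_vimage_eq flip: vimage_def)
  also have "{w. \<psi> w \<in> graph_ball E n (\<psi> v)} = graph_ball E n v"
    by (simp add: graph_ball_def relpowp_automorphism[OF assms])
  finally show ?thesis .
qed

context unimodular_transitive_graph
begin

abbreviation neighbours :: "'v \<Rightarrow> 'v set" where "neighbours v \<equiv> {u. E v u}"

lemma neighbours_automorphism:
  assumes "\<psi> \<in> automorphisms E"
  shows "neighbours (\<psi> v) = \<psi> ` neighbours v"
  using assms unfolding automorphisms_def bij_def by (auto simp: image_iff) (metis surjD)

lemma degree_pos: "0 < d"
proof -
  obtain u v :: 'v where "u \<noteq> v"
    using infinite_vertices by (metis UNIV_eq_I finite.emptyI finite_insert insertI1 singletonD)
  then obtain w where "E u w"
    using connected_graph[of u v] by (metis converse_rtranclpE)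
  then have "neighbours u \<noteq> {}" by auto
  then show ?thesis using degree[of u] finite_neighbours[of u] card_gt_0_iff by metis
qed

lemma finite_graph_ball: "finite (graph_ball E n v)"
proof -
  have "finite {w. (E ^^ k) v w}" for k
  proof (induction k)
    case (Suc k)
    have "{w. (E ^^ Suc k) v w} = (\<Union>y\<in>{y. (E ^^ k) v y}. neighbours y)" by auto
    then show ?case using Suc finite_neighbours by simp
  qed simp
  moreover have "graph_ball E n v = (\<Union>k\<in>{..n}. {w. (E ^^ k) v w})" by (auto simp: graph_ball_def)
  ultimately show ?thesis by simp
qed

lemma graph_ball_sym: "u \<in> graph_ball E n v \<longleftrightarrow> v \<in> graph_ball E n u"
proof -
  have "(E ^^ k) u v \<Longrightarrow> (E ^^ k) v u" for k u v
  proof (induction k arbitrary: v)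
    case (Suc k)
    then show ?case by (metis relpowp_Suc_E relpowp_Suc_I2 symmetric)
  qed simp
  then show ?thesis by (auto simp: graph_ball_def)
qed

lemma finite_subset_graph_ball:
  assumes "finite J"
  shows "\<exists>n. J \<subseteq> graph_ball E n v"
  using assms
proof induction
  case (insert u J)
  then obtain n where "J \<subseteq> graph_ball E n v" by auto
  moreover obtain k where "(E ^^ k) v u" using connected_graph rtranclp_imp_relpowp by metis
  ultimately have "insert u J \<subseteq> graph_ball E (max n k) v"
    unfolding graph_ball_def by (fastforce simp: le_max_iff_disj)
  then show ?case ..
qed simp

text \<open>  The mass transport principle in the form in which it is used: finite supports turn the sums in
  \<open>[0, \<infinity>]\<close> into finite sums of reals.\<close>

lemma mass_transport:
  fixes h :: "'v \<Rightarrow> 'v \<Rightarrow> real"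
  assumes "\<And>u v. 0 \<le> h u v" "\<And>\<psi> u v. \<psi> \<in> automorphisms E \<Longrightarrow> h (\<psi> u) (\<psi> v) = h u v"
    and S: "finite S" "\<And>v. v \<notin> S \<Longrightarrow> h x v = 0" and T: "finite T" "\<And>v. v \<notin> T \<Longrightarrow> h v x = 0"
  shows "(\<Sum>v\<in>S. h x v) = (\<Sum>v\<in>T. h v x)"
proof -
  have "(\<Sum>\<^sub>\<infinity>v\<in>UNIV. ennreal (h x v)) = (\<Sum>\<^sub>\<infinity>v\<in>UNIV. ennreal (h v x))"
    using unimodular assms(1,2) unfolding unimodular_def by blast
  moreover have "(\<Sum>\<^sub>\<infinity>v\<in>UNIV. ennreal (h x v)) = (\<Sum>\<^sub>\<infinity>v\<in>S. ennreal (h x v))"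
    using S by (intro infsum_cong_neutral) auto
  moreover have "(\<Sum>\<^sub>\<infinity>v\<in>UNIV. ennreal (h v x)) = (\<Sum>\<^sub>\<infinity>v\<in>T. ennreal (h v x))"
    using T by (intro infsum_cong_neutral) auto
  ultimately have "ennreal (\<Sum>v\<in>S. h x v) = ennreal (\<Sum>v\<in>T. h v x)"
    using S T assms(1) by (simp add: sum_ennreal)
  then show ?thesis using assms(1) by (simp add: ennreal_inj sum_nonneg)
qed

abbreviation cheeger :: real (\<open>\<tau>\<close>) where "\<tau> \<equiv> cheeger_constant E d"

lemma cheeger_le:
  assumes "finite W" "W \<noteq> {}"
  shows "\<tau> * (d * card W) \<le> card (edge_boundary E W)"
proof -
  have "\<tau> \<le> card (edge_boundary E W) / (real d * card W)"
    unfolding cheeger_constant_def using assms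
    by (intro cINF_lower) (auto intro!: bdd_belowI2[where m = 0])
  moreover have "0 < real d * card W" using assms degree_pos by (simp add: card_gt_0_iff)
  ultimately show ?thesis by (simp add: pos_le_divide_eq)
qed

lemma card_edge_boundary_le:
  assumes "finite W" "finite K" "\<And>v. v \<in> W \<Longrightarrow> neighbours v \<subseteq> K"
  shows "card (edge_boundary E W) \<le> (\<Sum>v\<in>K - W. card (neighbours v \<inter> W))"
proof -
  let ?P = "SIGMA v:K - W. neighbours v \<inter> W"
  have "edge_boundary E W \<subseteq> (\<lambda>(v, w). {v, w}) ` ?P"
  proof
    fix e assume "e \<in> edge_boundary E W"
    then obtain u v where uv: "e = {u, v}" "E u v" "card ({u, v} \<inter> W) = 1"
      by (auto simp: edge_boundary_def edges_def)
    have "u \<noteq> v" using uv irreflexive by auto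
    then have "(u \<in> W \<and> v \<notin> W) \<or> (u \<notin> W \<and> v \<in> W)"
      using uv(3) by (cases "u \<in> W"; cases "v \<in> W") auto
    then show "e \<in> (\<lambda>(v, w). {v, w}) ` ?P"
    proof
      assume "u \<in> W \<and> v \<notin> W"
      then have "(v, u) \<in> ?P" using uv assms(3)[of u] symmetric by auto
      then show ?thesis using uv(1) by (intro image_eqI[of _ _ "(v, u)"]) auto
    next
      assume "u \<notin> W \<and> v \<in> W"
      then have "(u, v) \<in> ?P" using uv assms(3)[of v] symmetric by auto
      then show ?thesis using uv(1) by (intro image_eqI[of _ _ "(u, v)"]) auto
    qed
  qed
  moreover have fin: "finite ?P" using assms by auto
  ultimately have "card (edge_boundary E W) \<le> card ?P"
    using card_image_le[OF fin] card_mono[OF finite_imageI[OF fin]] le_trans by blast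
  also have "\<dots> = (\<Sum>v\<in>K - W. card (neighbours v \<inter> W))"
    using assms by (simp add: card_SigmaI)
  finally show ?thesis .
qed

lemma cheeger_nonneg: "0 \<le> \<tau>"
  unfolding cheeger_constant_def
  by (intro cINF_greatest) (auto intro!: exI[of _ "{undefined}"])

lemma cheeger_le_1: "\<tau> \<le> 1"
proof -
  fix x :: 'v
  have "\<tau> * (d * card {x}) \<le> card (edge_boundary E {x})"
    by (intro cheeger_le) auto
  also have "card (edge_boundary E {x}) \<le> (\<Sum>v\<in>neighbours x - {x}. card (neighbours v \<inter> {x}))"
    using finite_neighbours by (intro card_edge_boundary_le) auto
  also have "\<dots> \<le> (\<Sum>v\<in>neighbours x - {x}. 1)"
    by (intro sum_mono card_le_Suc0_iff_eq[THEN iffD2, folded One_nat_def]) auto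
  also have "\<dots> = d" using irreflexive degree[of x] by simp
  finally show ?thesis using degree_pos by simp
qed

text \<open>  A level-set argument. For the indicator of \<open>W\<close> the right-hand side counts the ordered adjacent pairs
  that meet \<open>W\<close>, of which there are \<open>d |W| + |\<partial>W|\<close>, and the claim is the Cheeger inequality. A general
  \<open>f\<close> is a positive combination of the indicators of its superlevel sets, and the maximum is additive
  over this combination. The induction removes the lowest level, that is the smallest positive value
  of \<open>f\<close> on the support.\<close>

lemma sum_max_over_edges_ge:
  fixes f :: "'v \<Rightarrow> real"
  assumes "\<And>v. 0 \<le> f v" "finite K" "\<And>v. f v \<noteq> 0 \<Longrightarrow> insert v (neighbours v) \<subseteq> K"
  shows "(1 + \<tau>) * d * (\<Sum>v\<in>K. f v) \<le> (\<Sum>v\<in>K. \<Sum>w\<in>neighbours v. max (f v) (f w))"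
  using assms(1,3)
proof (induction "card {v. f v \<noteq> 0}" arbitrary: f rule: less_induct)
  case less
  define W where "W = {v. f v \<noteq> 0}"
  have WK: "W \<subseteq> K" "finite W" using less.prems(2) assms(2) by (auto simp: W_def intro: finite_subset)
  show ?case
  proof (cases "W = {}")
    case True
    then have "f = (\<lambda>_. 0)" by (auto simp: W_def)
    then show ?thesis by simp
  next
    case False
    define m where "m = Min (f ` W)"
    define g where "g v = (if v \<in> W then f v - m else 0)" for v
    have m: "m \<in> f ` W" "\<And>v. v \<in> W \<Longrightarrow> m \<le> f v"
      using WK False by (auto simp: m_def)
    have "m > 0" using m(1) less.prems(1) by (auto simp: W_def less_le)
    have supp: "{v. g v \<noteq> 0} \<subset> W" using m(1) by (auto simp: g_def)
    have g0: "f v \<noteq> 0" if "g v \<noteq> 0" for v using that by (auto simp: g_def W_def)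
    have "(1 + \<tau>) * d * (\<Sum>v\<in>K. g v) \<le> (\<Sum>v\<in>K. \<Sum>w\<in>neighbours v. max (g v) (g w))"
    proof (rule less.hyps)
      show "card {v. g v \<noteq> 0} < card {v. f v \<noteq> 0}"
        using supp WK(2) unfolding W_def[symmetric] by (rule psubset_card_mono[rotated])
      show "0 \<le> g v" for v using m(2) by (simp add: g_def)
    qed (use g0 less.prems(2) in blast)
    moreover have "f v = g v + m * of_bool (v \<in> W)" for v
      by (auto simp: g_def W_def)
    then have "(\<Sum>v\<in>K. f v) = (\<Sum>v\<in>K. g v) + m * card W"
      using WK assms(2) by (simp add: sum.distrib sum_distrib_left[symmetric] Int_absorb1)
    moreover have "max (f v) (f w) = max (g v) (g w) + m * of_bool (v \<in> W \<or> w \<in> W)" for v w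
      using m(2)[of v] m(2)[of w] \<open>m > 0\<close> by (auto simp: g_def W_def)
    then have "(\<Sum>v\<in>K. \<Sum>w\<in>neighbours v. max (f v) (f w)) = (\<Sum>v\<in>K. \<Sum>w\<in>neighbours v. max (g v) (g w))
        + m * (\<Sum>v\<in>K. \<Sum>w\<in>neighbours v. of_bool (v \<in> W \<or> w \<in> W))"
      by (simp add: sum.distrib sum_distrib_left)
    moreover have "(1 + \<tau>) * d * card W \<le> (\<Sum>v\<in>K. \<Sum>w\<in>neighbours v. of_bool (v \<in> W \<or> w \<in> W))"
    proof -
      have "(1 + \<tau>) * d * card W \<le> d * card W + card (edge_boundary E W)"
        using cheeger_le[OF WK(2) False] by (simp add: algebra_simps)
      also have "\<dots> \<le> real (d * card W + (\<Sum>v\<in>K - W. card (neighbours v \<inter> W)))"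
        using WK less.prems(2)
        by (intro of_nat_mono add_left_mono card_edge_boundary_le assms(2)) (auto simp: W_def)
      also have "real (d * card W + (\<Sum>v\<in>K - W. card (neighbours v \<inter> W)))
          = (\<Sum>v\<in>W. \<Sum>w\<in>neighbours v. of_bool (v \<in> W \<or> w \<in> W))
           + (\<Sum>v\<in>K - W. \<Sum>w\<in>neighbours v. of_bool (v \<in> W \<or> w \<in> W))"
      proof -
        have "(\<Sum>w\<in>neighbours v. of_bool (v \<in> W \<or> w \<in> W)) = real d" if "v \<in> W" for v
          using that degree by simp
        moreover have "(\<Sum>w\<in>neighbours v. of_bool (v \<in> W \<or> w \<in> W)) = real (card (neighbours v \<inter> W))"
          if "v \<in> K - W" for v
          using that finite_neighbours by (simp add: Int_def)
        ultimately show ?thesis by simp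
      qed
      also have "\<dots> = (\<Sum>v\<in>K. \<Sum>w\<in>neighbours v. of_bool (v \<in> W \<or> w \<in> W))"
        using WK assms(2) by (simp add: sum.subset_diff[of W K])
      finally show ?thesis .
    qed
    then have "m * ((1 + \<tau>) * d * card W) \<le> m * (\<Sum>v\<in>K. \<Sum>w\<in>neighbours v. of_bool (v \<in> W \<or> w \<in> W))"
      using \<open>m > 0\<close> by (intro mult_left_mono) auto
    ultimately show ?thesis by (simp add: algebra_simps)
  qed
qed

text \<open>  For fixed \<open>u\<close>, the Cheeger inequality bounds sums over the vertices \<open>v\<close> of the weights \<open>a u v\<close>. Entropy
  will need the sum over the sources \<open>u\<close> at a fixed vertex \<open>x\<close> instead. The mass transport principle
  exchanges the two, once for \<open>a\<close> itself and once for the sum of \<open>max (a u v) (a u w)\<close> over the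
  neighbours \<open>w\<close> of \<open>v\<close>.\<close>

lemma expansion_of_invariant_weights:
  fixes a :: "'v \<Rightarrow> 'v \<Rightarrow> real"
  assumes nonneg: "\<And>u v. 0 \<le> a u v"
    and inv: "\<And>\<psi> u v. \<psi> \<in> automorphisms E \<Longrightarrow> a (\<psi> u) (\<psi> v) = a u v"
    and supp: "\<And>u v. a u v \<noteq> 0 \<Longrightarrow> u \<in> graph_ball E n v"
  shows "(1 + \<tau>) * d * (\<Sum>u\<in>graph_ball E n x. a u x)
    \<le> (\<Sum>w\<in>neighbours x. \<Sum>u\<in>graph_ball E n x \<union> graph_ball E n w. max (a u x) (a u w))"
proof -
  let ?B = "graph_ball E n"
  define K where "K = ?B x \<union> (\<Union>v\<in>?B x. neighbours v)"
  define T where "T = ?B x \<union> (\<Union>w\<in>neighbours x. ?B w)"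
  define h where "h u v = (\<Sum>w\<in>neighbours v. max (a u v) (a u w))" for u v
  have supp': "a u v = 0" if "u \<notin> ?B v \<or> v \<notin> ?B u" for u v
    using that supp graph_ball_sym by metis
  have fin: "finite K" "finite T" "finite (?B x)"
    using finite_graph_ball finite_neighbours by (auto simp: K_def T_def)
  have "(1 + \<tau>) * d * (\<Sum>v\<in>K. a x v) \<le> (\<Sum>v\<in>K. h x v)"
    unfolding h_def
  proof (rule sum_max_over_edges_ge)
    fix v assume "a x v \<noteq> 0"
    then have "v \<in> ?B x" using supp' by blast
    then show "insert v (neighbours v) \<subseteq> K" by (auto simp: K_def)
  qed (use nonneg fin in auto)
  also have "(\<Sum>v\<in>K. a x v) = (\<Sum>u\<in>?B x. a u x)"
    using nonneg inv fin supp' by (intro mass_transport) (auto simp: K_def)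
  also have "(\<Sum>v\<in>K. h x v) = (\<Sum>u\<in>T. h u x)"
  proof (rule mass_transport)
    show "0 \<le> h u v" for u v
      unfolding h_def using nonneg by (intro sum_nonneg) (auto simp: le_max_iff_disj)
    show "h (\<psi> u) (\<psi> v) = h u v" if "\<psi> \<in> automorphisms E" for \<psi> u v
    proof -
      have "inj \<psi>" using that by (auto simp: automorphisms_def bij_def)
      then show ?thesis
        unfolding h_def neighbours_automorphism[OF that]
        by (subst sum.reindex) (auto simp: inv[OF that] inj_on_def)
    qed
    show "h x v = 0" if "v \<notin> K" for v
    proof -
      have "v \<notin> ?B x" "w \<notin> ?B x" if "E v w" for w
        using \<open>v \<notin> K\<close> that symmetric by (auto simp: K_def)
      then show ?thesis
        unfolding h_def by (intro sum.neutral ballI) (simp add: supp')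
    qed
    show "h v x = 0" if "v \<notin> T" for v
      unfolding h_def using that supp'
      by (intro sum.neutral ballI) (auto simp: T_def)
  qed (use fin in auto)
  also have "\<dots> = (\<Sum>w\<in>neighbours x. \<Sum>u\<in>T. max (a u x) (a u w))"
    unfolding h_def by (rule sum.swap)
  also have "\<dots> = (\<Sum>w\<in>neighbours x. \<Sum>u\<in>?B x \<union> ?B w. max (a u x) (a u w))"
    using fin supp' by (intro sum.cong refl sum.mono_neutral_right) (auto simp: T_def)
  finally show ?thesis .
qed

end

section \<open>Entropy and independent sources\<close>

text \<open>  Finitely valued independent random variables \<open>Y u\<close>, from which all other variables will be built.\<close>

locale independent_sources = information_space M b for M :: "'a measure" and b :: real +
  fixes Y :: "'v \<Rightarrow> 'a \<Rightarrow> nat"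
  assumes simple_source: "simple_function M (Y u)"
    and indep_sources: "indep_vars (\<lambda>_. count_space UNIV) Y UNIV"
begin

definition joint :: "'v set \<Rightarrow> 'a \<Rightarrow> 'v \<Rightarrow> nat" where
  "joint S \<omega> = restrict (\<lambda>u. Y u \<omega>) S"

definition cond_entropy :: "('a \<Rightarrow> 'c) \<Rightarrow> 'v set \<Rightarrow> real" where
  "cond_entropy X S = \<H>(\<lambda>\<omega>. (X \<omega>, joint S \<omega>)) - \<H>(joint S)"

lemma joint_insert: "joint (insert u S) \<omega> = (joint S \<omega>)(u := Y u \<omega>)"
  by (auto simp: joint_def)

lemma joint_subset: "S \<subseteq> T \<Longrightarrow> joint S \<omega> = restrict (joint T \<omega>) S"
  by (auto simp: joint_def restrict_def fun_eq_iff)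

lemma restrict_joint_update: "restrict ((joint S \<omega>)(u := Y u \<omega>)) S = joint S \<omega>"
  by (auto simp: joint_def)

lemma simple_joint:
  assumes "finite S"
  shows "simple_function M (joint S)"
  using assms
proof induction
  case empty
  have "joint {} = (\<lambda>_. \<lambda>_. undefined)" by (auto simp: joint_def fun_eq_iff)
  then show ?case by simp
next
  case (insert u S)
  have "joint (insert u S) = (\<lambda>(f, y). f(u := y)) \<circ> (\<lambda>\<omega>. (joint S \<omega>, Y u \<omega>))"
    by (rule ext) (simp add: joint_insert)
  then show ?case
    using simple_function_compose[OF simple_function_Pair[OF insert.IH simple_source]] by metis
qed

lemma simple_joint_update:
  assumes "finite S"
  shows "simple_function M (\<lambda>\<omega>. (joint S \<omega>)(u := Y u \<omega>))"
  using simple_joint[of "insert u S"] assms by (simp add: joint_insert[symmetric])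

lemma sets_PiM_count_space_finite:
  assumes "finite S" "finite A" "A \<subseteq> extensional S"
  shows "A \<in> sets (PiM S (\<lambda>_. count_space UNIV))"
proof -
  have "{f} \<in> sets (PiM S (\<lambda>_. count_space UNIV))" if "f \<in> A" for f
  proof -
    have "{f} = (\<Pi>\<^sub>E i\<in>S. {f i})"
      using that assms by (intro PiE_singleton[symmetric]) auto
    then show ?thesis using assms by (simp add: sets_PiM_I_finite)
  qed
  then have "(\<Union>f\<in>A. {f}) \<in> sets (PiM S (\<lambda>_. count_space UNIV))"
    using assms by (intro sets.finite_UN) auto
  then show ?thesis by simp
qed

text \<open>  The two families are independent as variables in the product spaces. Only finitely many values occur, and
  the singletons of these are measurable there, so the same holds for the discrete sigma-algebras on the
  ranges, to which the entropy refers.\<close>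

lemma indep_joint:
  assumes "finite S" "finite T" "S \<inter> T = {}"
  shows "indep_var (count_space (joint S ` space M)) (joint S) (count_space (joint T ` space M)) (joint T)"
proof -
  let ?N = "\<lambda>S. PiM S (\<lambda>_. count_space UNIV) :: ('v \<Rightarrow> nat) measure"
  have "indep_var (?N S) (\<lambda>\<omega>. restrict (\<lambda>i. Y i \<omega>) S) (?N T) (\<lambda>\<omega>. restrict (\<lambda>i. Y i \<omega>) T)"
    using assms by (intro indep_var_restrict[OF indep_sources]) auto
  then have "indep_var (?N S) (joint S) (?N T) (joint T)"
    by (simp add: joint_def[abs_def])
  then have ind: "indep_set (sigma_sets (space M) {joint S -` A \<inter> space M |A. A \<in> sets (?N S)})
      (sigma_sets (space M) {joint T -` A \<inter> space M |A. A \<in> sets (?N T)})"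
    by (simp add: indep_var_eq)
  have rv: "random_variable (count_space (joint R ` space M)) (joint R)" if "finite R" for R
    using simple_joint[OF that] by (auto simp: simple_function_def measurable_count_space_eq2)
  have sub: "{joint R -` A \<inter> space M |A. A \<in> sets (count_space (joint R ` space M))}
      \<subseteq> {joint R -` A \<inter> space M |A. A \<in> sets (?N R)}" if R: "finite R" for R
  proof -
    have "A \<in> sets (?N R)" if "A \<subseteq> joint R ` space M" for A
      using that simple_functionD(1)[OF simple_joint[OF R]]
      by (intro sets_PiM_count_space_finite R) (auto intro: finite_subset simp: joint_def)
    then show ?thesis by auto
  qed
  show ?thesis
    unfolding indep_var_eq
  proof (intro conjI rv assms)
    show "indep_set
        (sigma_sets (space M) {joint S -` A \<inter> space M |A. A \<in> sets (count_space (joint S ` space M))})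
        (sigma_sets (space M) {joint T -` A \<inter> space M |A. A \<in> sets (count_space (joint T ` space M))})"
      using ind unfolding indep_set_def
    proof (rule indep_sets_mono_sets)
      fix i :: bool
      show "case_bool
          (sigma_sets (space M) {joint S -` A \<inter> space M |A. A \<in> sets (count_space (joint S ` space M))})
          (sigma_sets (space M) {joint T -` A \<inter> space M |A. A \<in> sets (count_space (joint T ` space M))}) i
        \<subseteq> case_bool (sigma_sets (space M) {joint S -` A \<inter> space M |A. A \<in> sets (?N S)})
            (sigma_sets (space M) {joint T -` A \<inter> space M |A. A \<in> sets (?N T)}) i"
        using sigma_sets_mono'[OF sub[OF assms(1)]] sigma_sets_mono'[OF sub[OF assms(2)]]
        by (cases i) (simp_all only: bool.case)
    qed
  qed
qed

lemma entropy_joint_insert: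
  assumes "finite S" "u \<notin> S"
  shows "\<H>(joint (insert u S)) = \<H>(joint S) + \<H>(joint {u})"
proof -
  have "\<H>(joint (insert u S)) = \<H>(\<lambda>\<omega>. (joint S \<omega>, joint {u} \<omega>))"
  proof (rule entropy_eq_of_mutual_functions[where f = "\<lambda>(f, g). f(u := g u)" 
        and g = "\<lambda>f. (restrict f S, restrict f {u})"])
    show "joint (insert u S) \<omega> = (case (joint S \<omega>, joint {u} \<omega>) of (f, g) \<Rightarrow> f(u := g u))" for \<omega>
      by (simp add: joint_insert joint_def[of "{u}"])
    show "(joint S \<omega>, joint {u} \<omega>) = (restrict (joint (insert u S) \<omega>) S, restrict (joint (insert u S) \<omega>) {u})" for \<omega>
      by (auto simp: joint_def)
  qed (use assms in \<open>auto intro!: simple_joint simple_function_Pair\<close>)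
  also have "\<dots> = \<H>(joint S) + \<H>(joint {u})"
    using assms by (intro entropy_indep_pair simple_joint indep_joint) auto
  finally show ?thesis .
qed

lemma cond_entropy_insert_le:
  assumes X: "simple_function M X" and S: "finite S"
  shows "cond_entropy X (insert u S) \<le> cond_entropy X S"
proof -
  note J = simple_joint[OF S] and Jx = simple_joint[OF finite.insertI[OF S], of u]
  have "\<H>(\<lambda>\<omega>. (X \<omega>, joint (insert u S) \<omega>)) = \<H>(\<lambda>\<omega>. (X \<omega>, Y u \<omega>, joint S \<omega>))"
    by (rule entropy_eq_of_mutual_functions[where f = "\<lambda>(x, y, f). (x, f(u := y))" 
          and g = "\<lambda>(x, f). (x, f u, restrict f S)"])
       (auto simp: joint_insert restrict_joint_update intro!: simple_function_Pair X Jx J simple_source simple_joint_update S)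
  moreover have "\<H>(joint (insert u S)) = \<H>(\<lambda>\<omega>. (Y u \<omega>, joint S \<omega>))"
    by (rule entropy_eq_of_mutual_functions[where f = "\<lambda>(y, f). f(u := y)" and g = "\<lambda>f. (f u, restrict f S)"])
       (auto simp: joint_insert restrict_joint_update intro!: simple_function_Pair Jx J simple_source simple_joint_update S)
  ultimately show ?thesis
    using entropy_submodular[OF X simple_source[of u] J] by (simp add: cond_entropy_def)
qed

text \<open>  By the chain rule the difference of the two conditional entropies is the entropy of \<open>X'\<close> given \<open>X\<close>
  and the exposed sources, and exposing \<open>Y u\<close> can only decrease it. So an exposed source reveals at
  least as much about the pair as about each component.\<close>

lemma cond_entropy_pair_insert:
  assumes X: "simple_function M X" and X': "simple_function M X'" and S: "finite S"
  shows "cond_entropy X S - cond_entropy X (insert u S)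
    \<le> cond_entropy (\<lambda>\<omega>. (X \<omega>, X' \<omega>)) S - cond_entropy (\<lambda>\<omega>. (X \<omega>, X' \<omega>)) (insert u S)"
proof -
  note J = simple_joint[OF S] and Jx = simple_joint[OF finite.insertI[OF S], of u]
  have "\<H>(\<lambda>\<omega>. ((X \<omega>, X' \<omega>), joint (insert u S) \<omega>)) = \<H>(\<lambda>\<omega>. (X' \<omega>, Y u \<omega>, X \<omega>, joint S \<omega>))"
    by (rule entropy_eq_of_mutual_functions[where f = "\<lambda>(x', y, x, f). ((x, x'), f(u := y))" 
          and g = "\<lambda>((x, x'), f). (x', f u, x, restrict f S)"])
       (auto simp: joint_insert restrict_joint_update intro!: simple_function_Pair X X' Jx J simple_source simple_joint_update S)
  moreover have "\<H>(\<lambda>\<omega>. (X \<omega>, joint (insert u S) \<omega>)) = \<H>(\<lambda>\<omega>. (Y u \<omega>, X \<omega>, joint S \<omega>))"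
    by (rule entropy_eq_of_mutual_functions[where f = "\<lambda>(y, x, f). (x, f(u := y))" 
          and g = "\<lambda>(x, f). (f u, x, restrict f S)"])
       (auto simp: joint_insert restrict_joint_update intro!: simple_function_Pair X Jx J simple_source simple_joint_update S)
  moreover have "\<H>(\<lambda>\<omega>. ((X \<omega>, X' \<omega>), joint S \<omega>)) = \<H>(\<lambda>\<omega>. (X' \<omega>, X \<omega>, joint S \<omega>))"
    by (rule entropy_eq_of_mutual_functions[where f = "\<lambda>(x', x, f). ((x, x'), f)" 
          and g = "\<lambda>((x, x'), f). (x', x, f)"])
       (auto intro!: simple_function_Pair X X' J)
  ultimately show ?thesis
    using entropy_submodular[OF X' simple_source[of u] simple_function_Pair[OF X J]] by (simp add: cond_entropy_def)
qed

lemma cond_entropy_swap: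
  assumes X: "simple_function M X" and X': "simple_function M X'" and S: "finite S"
  shows "cond_entropy (\<lambda>\<omega>. (X \<omega>, X' \<omega>)) S = cond_entropy (\<lambda>\<omega>. (X' \<omega>, X \<omega>)) S"
proof -
  have "\<H>(\<lambda>\<omega>. ((X \<omega>, X' \<omega>), joint S \<omega>)) = \<H>(\<lambda>\<omega>. ((X' \<omega>, X \<omega>), joint S \<omega>))"
    by (rule entropy_eq_of_mutual_functions[where f = "\<lambda>((x, x'), f). ((x', x), f)" and g = "\<lambda>((x, x'), f). ((x', x), f)"])
       (auto intro!: simple_function_Pair X X' simple_joint S)
  then show ?thesis by (simp add: cond_entropy_def)
qed

lemma joint_empty: "joint {} \<omega> = (\<lambda>_. undefined)"
  by (auto simp: joint_def fun_eq_iff)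

lemma cond_entropy_empty:
  assumes X: "simple_function M X"
  shows "cond_entropy X {} = \<H>(X)"
proof -
  have "\<H>(\<lambda>\<omega>. (X \<omega>, joint {} \<omega>)) = \<H>(X)"
    by (rule entropy_eq_of_mutual_functions[where f = "\<lambda>x. (x, \<lambda>_. undefined)" and g = fst])
       (auto intro!: simple_function_Pair X simple_joint simp: joint_empty)
  moreover have "\<H>(joint {}) = 0"
    using entropy_simple_distributed[OF simple_distributedI[OF simple_joint[OF finite.emptyI] measure_nonneg refl]]
      not_empty
    by (simp add: joint_empty image_constant_conv vimage_def prob_space)
  ultimately show ?thesis by (simp add: cond_entropy_def)
qed

definition determined_by :: "('a \<Rightarrow> 'c) \<Rightarrow> 'v set \<Rightarrow> bool" where
  "determined_by X B \<longleftrightarrow> finite B \<and> (\<exists>f. \<forall>\<omega>\<in>space M. X \<omega> = f (joint B \<omega>))"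

lemma determined_by_superset:
  assumes "determined_by X B" "B \<subseteq> C" "finite C"
  shows "determined_by X C"
proof -
  obtain f where "\<forall>\<omega>\<in>space M. X \<omega> = f (joint B \<omega>)" using assms by (auto simp: determined_by_def)
  then have "\<forall>\<omega>\<in>space M. X \<omega> = (\<lambda>g. f (restrict g B)) (joint C \<omega>)"
    using joint_subset[OF assms(2)] by simp
  then show ?thesis using assms by (auto simp: determined_by_def)
qed

lemma determined_by_Pair:
  assumes "determined_by X B" "determined_by X' B"
  shows "determined_by (\<lambda>\<omega>. (X \<omega>, X' \<omega>)) B"
proof -
  obtain f g where "\<forall>\<omega>\<in>space M. X \<omega> = f (joint B \<omega>)" "\<forall>\<omega>\<in>space M. X' \<omega> = g (joint B \<omega>)"
    using assms by (auto simp: determined_by_def)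
  then have "\<exists>k. \<forall>\<omega>\<in>space M. (X \<omega>, X' \<omega>) = k (joint B \<omega>)" 
    by (intro exI[of _ "\<lambda>h. (f h, g h)"]) simp
  then show ?thesis using assms unfolding determined_by_def by blast
qed

lemma simple_determined_by:
  assumes "determined_by X B"
  shows "simple_function M X"
proof -
  obtain f where f: "\<forall>\<omega>\<in>space M. X \<omega> = f (joint B \<omega>)" and "finite B"
    using assms by (auto simp: determined_by_def)
  have "simple_function M (f \<circ> joint B)"
    by (intro simple_function_compose simple_joint \<open>finite B\<close>)
  then show ?thesis using f by (subst simple_function_cong[where g = "f \<circ> joint B"]) auto
qed

lemma cond_entropy_determined:
  assumes "determined_by X B"
  shows "cond_entropy X B = 0"
proof -
  obtain f where f: "\<forall>\<omega>\<in>space M. X \<omega> = f (joint B \<omega>)" and "finite B"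
    using assms by (auto simp: determined_by_def)
  have "\<H>(\<lambda>\<omega>. (X \<omega>, joint B \<omega>)) = \<H>(joint B)"
    by (rule entropy_eq_of_mutual_functions[where f = "\<lambda>g. (f g, g)" and g = snd])
       (use f in \<open>auto intro!: simple_function_Pair simple_joint \<open>finite B\<close> simple_determined_by[OF assms]\<close>)
  then show ?thesis by (simp add: cond_entropy_def)
qed

text \<open>  The one place where independence of the sources matters. If \<open>u\<close> lies outside \<open>B\<close> and \<open>S\<close>, then \<open>Y u\<close> is
  independent of the sources in \<open>S \<union> B\<close>, hence of \<open>X\<close> together with the sources in \<open>S\<close>. In the
  proof this is submodularity for \<open>Y u\<close> and the sources in \<open>B\<close>, given \<open>X\<close> and the sources in \<open>S\<close>.\<close>

lemma cond_entropy_irrelevant_source: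
  assumes det: "determined_by X B" and "u \<notin> B" and S: "finite S"
  shows "cond_entropy X (insert u S) = cond_entropy X S"
proof (cases "u \<in> S")
  case True
  then show ?thesis by (simp add: insert_absorb)
next
  case False
  obtain f where f: "\<And>\<omega>. \<omega> \<in> space M \<Longrightarrow> X \<omega> = f (joint B \<omega>)" and B: "finite B"
    using det by (auto simp: determined_by_def)
  note X = simple_determined_by[OF det]
  note J = simple_joint[OF S] and Jx = simple_joint[OF finite.insertI[OF S], of u] and JB = simple_joint[OF B]
  note XJ = simple_function_Pair[OF X J]
  have r: "restrict (joint (insert u (S \<union> B)) \<omega>) B = joint B \<omega>" "restrict (joint (insert u (S \<union> B)) \<omega>) S = joint S \<omega>"
      "restrict (joint (S \<union> B) \<omega>) B = joint B \<omega>" "restrict (joint (S \<union> B) \<omega>) S = joint S \<omega>"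
      "joint (insert u (S \<union> B)) \<omega> u = Y u \<omega>" for \<omega>
    by (auto simp: joint_def)
  have m: "joint (S \<union> B) \<omega> = (\<lambda>w. if w \<in> B then joint B \<omega> w else joint S \<omega> w)" for \<omega>
    by (auto simp: joint_def)
  have "\<H>(joint (insert u (S \<union> B))) = \<H>(\<lambda>\<omega>. (Y u \<omega>, joint B \<omega>, X \<omega>, joint S \<omega>))"
  proof (rule entropy_eq_of_mutual_functions[where 
          f = "\<lambda>(y, g, x, h). (\<lambda>w. if w \<in> B then g w else h w)(u := y)" 
          and g = "\<lambda>h. (h u, restrict h B, f (restrict h B), restrict h S)"])
    show "joint (insert u (S \<union> B)) \<omega> = (case (Y u \<omega>, joint B \<omega>, X \<omega>, joint S \<omega>) of
        (y, g, x, h) \<Rightarrow> (\<lambda>w. if w \<in> B then g w else h w)(u := y))" for \<omega>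
      by (simp add: joint_insert m)
  qed (use S B f in \<open>auto intro!: simple_function_Pair X J JB simple_source simple_joint simp: r\<close>)
  moreover have "\<H>(joint (S \<union> B)) = \<H>(\<lambda>\<omega>. (joint B \<omega>, X \<omega>, joint S \<omega>))"
  proof (rule entropy_eq_of_mutual_functions[where 
          f = "\<lambda>(g, x, h). (\<lambda>w. if w \<in> B then g w else h w)" 
          and g = "\<lambda>h. (restrict h B, f (restrict h B), restrict h S)"])
    show "joint (S \<union> B) \<omega> = (case (joint B \<omega>, X \<omega>, joint S \<omega>) of
        (g, x, h) \<Rightarrow> (\<lambda>w. if w \<in> B then g w else h w))" for \<omega>
      by (simp add: m)
  qed (use S B f in \<open>auto intro!: simple_function_Pair X J JB simple_source simple_joint simp: r\<close>)
  moreover have "\<H>(\<lambda>\<omega>. (X \<omega>, joint (insert u S) \<omega>)) = \<H>(\<lambda>\<omega>. (Y u \<omega>, X \<omega>, joint S \<omega>))"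
    by (rule entropy_eq_of_mutual_functions[where f = "\<lambda>(y, x, f). (x, f(u := y))" 
          and g = "\<lambda>(x, f). (f u, x, restrict f S)"])
       (auto simp: joint_insert restrict_joint_update intro!: simple_function_Pair X Jx J simple_source simple_joint_update S)
  moreover have "\<H>(joint (insert u (S \<union> B))) = \<H>(joint (S \<union> B)) + \<H>(joint {u})" "\<H>(joint (insert u S)) = \<H>(joint S) + \<H>(joint {u})"
    using S B \<open>u \<notin> B\<close> False by (auto intro!: entropy_joint_insert)
  ultimately have "cond_entropy X S \<le> cond_entropy X (insert u S)"
    using entropy_submodular[OF simple_source[of u] JB XJ] by (simp add: cond_entropy_def)
  then show ?thesis using cond_entropy_insert_le[OF X S, of u] by simp
qed

text \<open>  The expected amount of information about \<open>X\<close> that \<open>Y u\<close> reveals when the sources are exposed in a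
  uniformly random order. A random order is used since an infinite transitive graph need not have an order
  that is invariant under its automorphisms, whereas this average is invariant.\<close>

definition contribution :: "('a \<Rightarrow> 'c) \<Rightarrow> 'v set \<Rightarrow> 'v \<Rightarrow> real" where
  "contribution X B u = (if u \<in> B then shapley (cond_entropy X) B u else 0)"

lemma contribution_nonneg:
  assumes "determined_by X B"
  shows "0 \<le> contribution X B u"
  using assms unfolding contribution_def determined_by_def
  by (auto intro!: shapley_nonneg cond_entropy_insert_le simple_determined_by[OF assms] dest: finite_subset)

lemma sum_contribution:
  assumes "determined_by X B"
  shows "(\<Sum>u\<in>B. contribution X B u) = \<H>(X)"
  using assms shapley_efficient[of B "cond_entropy X"] cond_entropy_empty[OF simple_determined_by[OF assms]]
    cond_entropy_determined[OF assms]
  by (simp add: contribution_def determined_by_def)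

text \<open>  Sources outside \<open>B\<close> are null players. Contributions to different variables can therefore be
  compared in a common set of sources.\<close>

lemma shapley_superset_eq_contribution:
  assumes det: "determined_by X B" and "B \<subseteq> C" "finite C"
  shows "shapley (cond_entropy X) C u = contribution X B u"
proof (cases "u \<in> B")
  case True
  have "finite B" using det by (simp add: determined_by_def)
  then show ?thesis
    using shapley_union_null_players[OF \<open>finite C\<close> \<open>finite B\<close> True, of "cond_entropy X"] 
      cond_entropy_irrelevant_source[OF det] True \<open>B \<subseteq> C\<close>
    by (simp add: contribution_def Un_absorb1)
next
  case False
  then show ?thesis
    using shapley_null_player[OF \<open>finite C\<close>] cond_entropy_irrelevant_source[OF det]
    by (simp add: contribution_def)
qed

lemma sum_max_contribution_le:
  assumes X: "determined_by X B" and X': "determined_by X' B'"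
  shows "(\<Sum>u\<in>B \<union> B'. max (contribution X B u) (contribution X' B' u)) \<le> \<H>(\<lambda>\<omega>. (X \<omega>, X' \<omega>))"
proof -
  define C where "C = B \<union> B'"
  have C: "finite C" "B \<subseteq> C" "B' \<subseteq> C"
    using X X' by (auto simp: C_def determined_by_def)
  let ?XX = "\<lambda>\<omega>. (X \<omega>, X' \<omega>)"
  note sX = simple_determined_by[OF X] and sX' = simple_determined_by[OF X']
  have det: "determined_by ?XX C"
    using C by (intro determined_by_Pair determined_by_superset[OF X] determined_by_superset[OF X'])
  have "max (contribution X B u) (contribution X' B' u) \<le> contribution ?XX C u" if "u \<in> C" for u
  proof -
    have fin: "finite S" if "S \<subseteq> C - {u}" for S using that C finite_subset[of S C] by auto
    have "shapley (cond_entropy X) C u \<le> shapley (cond_entropy ?XX) C u"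
      by (intro shapley_mono cond_entropy_pair_insert sX sX' fin)
    moreover have "shapley (cond_entropy X') C u \<le> shapley (cond_entropy ?XX) C u"
      by (rule shapley_mono)
         (use fin cond_entropy_pair_insert[OF sX' sX] cond_entropy_swap[OF sX' sX] in simp)
    ultimately show ?thesis
      using that C by (simp add: shapley_superset_eq_contribution[OF X] shapley_superset_eq_contribution[OF X']
          contribution_def[of ?XX])
  qed
  then have "(\<Sum>u\<in>C. max (contribution X B u) (contribution X' B' u)) \<le> (\<Sum>u\<in>C. contribution ?XX C u)"
    by (intro sum_mono)
  then show ?thesis using sum_contribution[OF det] by (simp add: C_def)
qed

end

section \<open>The edge-vertex inequality for block factors\<close>

abbreviation iid_uniform :: "('v \<Rightarrow> real) measure" where
  "iid_uniform \<equiv> \<Pi>\<^sub>M v\<in>UNIV. uniform01"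

lemma space_uniform01: "space uniform01 = {0..1}"
  by (simp add: uniform01_def space_restrict_space)

lemma prob_space_uniform01: "prob_space uniform01"
  unfolding uniform01_def by (intro prob_space_restrict_space) auto

lemma prob_space_iid_uniform: "prob_space iid_uniform"
  by (intro prob_space_PiM prob_space_uniform01)

lemma space_iid_uniform: "space iid_uniform = UNIV \<rightarrow> {0..1}"
  by (auto simp: space_PiM space_uniform01)

context
  fixes \<psi> :: "'v \<Rightarrow> 'v"
  assumes bij: "bij \<psi>"
begin

lemma relabel_measurable: "(\<lambda>z. z \<circ> \<psi>) \<in> iid_uniform \<rightarrow>\<^sub>M iid_uniform"
proof -
  have "(\<lambda>z. \<lambda>v\<in>UNIV. z (\<psi> v)) \<in> iid_uniform \<rightarrow>\<^sub>M iid_uniform"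
    by (intro measurable_restrict measurable_component_singleton) auto
  then show ?thesis by (simp add: comp_def restrict_def)
qed

lemma distr_relabel: "distr iid_uniform iid_uniform (\<lambda>z. z \<circ> \<psi>) = iid_uniform"
  using distr_PiM_reindex[of UNIV "\<lambda>_. uniform01" \<psi> UNIV] prob_space_uniform01 bij
  by (simp add: comp_def bij_def restrict_def)

lemma relabel_space: "(\<lambda>z. z \<circ> \<psi>) ` space iid_uniform = space iid_uniform"
proof -
  have "z \<in> (\<lambda>z. z \<circ> \<psi>) ` (UNIV \<rightarrow> {0..1})" if "z \<in> UNIV \<rightarrow> {0..1::real}" for z
  proof (rule image_eqI)
    show "z = (z \<circ> inv \<psi>) \<circ> \<psi>" using bij by (simp add: comp_def bij_def fun_eq_iff)
    show "z \<circ> inv \<psi> \<in> UNIV \<rightarrow> {0..1}" using that by auto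
  qed
  then show ?thesis by (auto simp: space_iid_uniform)
qed

end

lemma indep_vars_coordinates:
  "prob_space.indep_vars iid_uniform (\<lambda>_. uniform01) (\<lambda>(v :: 'v) z. z v) UNIV"
proof -
  interpret prob_space "iid_uniform :: ('v \<Rightarrow> real) measure" by (rule prob_space_iid_uniform)
  have "distr iid_uniform iid_uniform (\<lambda>z. \<lambda>v\<in>UNIV. z v) = (iid_uniform :: ('v \<Rightarrow> real) measure)"
    by (simp add: distr_id2 restrict_def)
  moreover have "distr iid_uniform uniform01 (\<lambda>z. z v) = uniform01" for v :: 'v
    by (intro distr_PiM_component prob_space_uniform01) auto
  ultimately show ?thesis
    by (subst indep_vars_iff_distr_eq_PiM) (auto intro!: measurable_component_singleton)
qed

lemma independent_sources_iid_uniform: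
  assumes D: "simple_function uniform01 D"
  shows "independent_sources iid_uniform (exp 1) (\<lambda>(v :: 'v) z. D (z v))"
proof -
  interpret prob_space "iid_uniform :: ('v \<Rightarrow> real) measure" by (rule prob_space_iid_uniform)
  interpret information_space "iid_uniform :: ('v \<Rightarrow> real) measure" "exp 1"
    by unfold_locales simp
  have Dm: "D \<in> uniform01 \<rightarrow>\<^sub>M count_space UNIV"
    using D by (rule measurable_simple_function)
  show ?thesis
  proof
    fix v :: 'v
    have "(\<lambda>z. D (z v)) \<in> iid_uniform \<rightarrow>\<^sub>M count_space UNIV"
      by (rule measurable_compose[OF _ Dm]) (rule measurable_component_singleton, simp)
    moreover have "(\<lambda>z. D (z v)) ` space iid_uniform \<subseteq> D ` space uniform01"
      by (auto simp: space_PiM)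
    then have "finite ((\<lambda>z. D (z v)) ` space iid_uniform)"
      using simple_functionD(1)[OF D] finite_subset by blast
    ultimately show "simple_function iid_uniform (\<lambda>z. D (z v))"
      by (auto simp: simple_function_def)
  next
    show "indep_vars (\<lambda>_. count_space UNIV) (\<lambda>v z. D (z v)) UNIV"
      by (rule indep_vars_compose2[OF indep_vars_coordinates]) (rule Dm)
  qed
qed

definition shannon_entropy :: "'a measure \<Rightarrow> ('a \<Rightarrow> 'c) \<Rightarrow> real" where
  "shannon_entropy M X = prob_space.entropy M (exp 1) (count_space (X ` space M)) X"

lemma (in independent_sources) determined_byI:
  assumes "finite B"
    and eq: "\<And>\<omega> \<omega>'. \<omega> \<in> space M \<Longrightarrow> \<omega>' \<in> space M \<Longrightarrow> (\<And>u. u \<in> B \<Longrightarrow> Y u \<omega> = Y u \<omega>') \<Longrightarrow> X \<omega> = X \<omega>'"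
  shows "determined_by X B"
proof -
  define f where "f g = X (SOME \<omega>. \<omega> \<in> space M \<and> joint B \<omega> = g)" for g
  have "X \<omega> = f (joint B \<omega>)" if "\<omega> \<in> space M" for \<omega>
  proof -
    define \<omega>' where "\<omega>' = (SOME \<omega>'. \<omega>' \<in> space M \<and> joint B \<omega>' = joint B \<omega>)"
    have "\<omega>' \<in> space M \<and> joint B \<omega>' = joint B \<omega>"
      unfolding \<omega>'_def by (rule someI[of _ \<omega>]) (use that in simp)
    moreover from this have "Y u \<omega> = Y u \<omega>'" if "u \<in> B" for u
      using that unfolding joint_def by (metis restrict_apply')
    ultimately show ?thesis
      using eq[OF that, of \<omega>'] by (simp add: f_def \<omega>'_def)
  qed
  then show ?thesis using assms(1) by (auto simp: determined_by_def)
qed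

text \<open>  Relabelling the uniform variables by \<open>\<psi>\<close> preserves their law, and therefore every entropy. The
  sources indexed by \<open>S\<close> become those indexed by the image of \<open>S\<close>.\<close>

lemma entropy_with_sources_relabel:
  fixes X X' :: "('v \<Rightarrow> real) \<Rightarrow> 'c"
  assumes "independent_sources iid_uniform (exp 1) (\<lambda>(v :: 'v) z. D (z v))" and "bij \<psi>" "finite S"
    and X: "simple_function iid_uniform X" and eq: "\<And>z. z \<in> space iid_uniform \<Longrightarrow> X (z \<circ> \<psi>) = X' z"
  shows "shannon_entropy iid_uniform (\<lambda>z. (X' z, independent_sources.joint (\<lambda>v z. D (z v)) (\<psi> ` S) z))
    = shannon_entropy iid_uniform (\<lambda>z. (X z, independent_sources.joint (\<lambda>v z. D (z v)) S z))"
proof -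
  interpret independent_sources iid_uniform "exp 1" "\<lambda>(v :: 'v) z. D (z v)" by fact
  note relabel = relabel_measurable[OF \<open>bij \<psi>\<close>] distr_relabel[OF \<open>bij \<psi>\<close>] relabel_space[OF \<open>bij \<psi>\<close>]
  let ?XJ = "\<lambda>z. (X z, joint S z)"
  have sXJ: "simple_function iid_uniform ?XJ"
    by (intro simple_function_Pair X simple_joint \<open>finite S\<close>)
  have sc: "simple_function iid_uniform (f \<circ> (\<lambda>z. z \<circ> \<psi>))" if "simple_function iid_uniform f" for f :: "_ \<Rightarrow> 'd"
    using simple_function_comp[OF relabel(1) that] by (simp add: comp_def)
  have X': "simple_function iid_uniform X'"
    using sc[OF X] eq by (subst simple_function_cong[where g = "X \<circ> (\<lambda>z. z \<circ> \<psi>)"]) auto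
  have inv[simp]: "inv \<psi> (\<psi> u) = u" for u using \<open>bij \<psi>\<close> by (simp add: bij_def)
  have "entropy_Pow (?XJ \<circ> (\<lambda>z. z \<circ> \<psi>)) = entropy_Pow (?XJ)"
    by (rule entropy_comp_measure_preserving[OF relabel sXJ])
  moreover have "entropy_Pow (\<lambda>z. (X' z, joint (\<psi> ` S) z)) = entropy_Pow (?XJ \<circ> (\<lambda>z. z \<circ> \<psi>))"
  proof (rule entropy_eq_of_mutual_functions[where f = "\<lambda>(x, g). (x, restrict (g \<circ> inv \<psi>) (\<psi> ` S))"
          and g = "\<lambda>(x, g). (x, restrict (g \<circ> \<psi>) S)"])
    fix z :: "'v \<Rightarrow> real" assume z: "z \<in> space iid_uniform"
    have "joint (\<psi> ` S) z = restrict (joint S (z \<circ> \<psi>) \<circ> inv \<psi>) (\<psi> ` S)"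
      "joint S (z \<circ> \<psi>) = restrict (joint (\<psi> ` S) z \<circ> \<psi>) S"
      by (auto simp: joint_def fun_eq_iff)
    then show "(X' z, joint (\<psi> ` S) z) = (case (?XJ \<circ> (\<lambda>z. z \<circ> \<psi>)) z of (x, g) \<Rightarrow> (x, restrict (g \<circ> inv \<psi>) (\<psi> ` S)))"
      "(?XJ \<circ> (\<lambda>z. z \<circ> \<psi>)) z = (case (X' z, joint (\<psi> ` S) z) of (x, g) \<Rightarrow> (x, restrict (g \<circ> \<psi>) S))"
      using eq[OF z] by simp_all
  qed (intro simple_function_Pair X' simple_joint finite_imageI \<open>finite S\<close> sc[OF sXJ])+
  ultimately show ?thesis by (simp add: shannon_entropy_def)
qed

text \<open>  Each \<open>X v\<close> is a function of the discretised variables in the ball around \<open>v\<close>, chosen equivariantly.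
  The contributions of the sources then form an invariant system of weights. They add up to the entropy of
  a vertex, and the sum of their maxima over the two ends of an edge is at most the entropy of the edge.\<close>

theorem (in unimodular_transitive_graph) edge_vertex_inequality:
  fixes X :: "'v \<Rightarrow> ('v \<Rightarrow> real) \<Rightarrow> 'c"
  assumes D: "simple_function uniform01 (D :: real \<Rightarrow> nat)"
    and block: "\<And>v z z'. z \<in> space iid_uniform \<Longrightarrow> z' \<in> space iid_uniform \<Longrightarrow>
      (\<And>u. u \<in> graph_ball E n v \<Longrightarrow> D (z u) = D (z' u)) \<Longrightarrow> X v z = X v z'"
    and equiv: "\<And>\<psi> z v. \<psi> \<in> automorphisms E \<Longrightarrow> z \<in> space iid_uniform \<Longrightarrow> X v (z \<circ> \<psi>) = X (\<psi> v) z"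
  shows "(1 + \<tau>) * d * shannon_entropy iid_uniform (X x)
    \<le> (\<Sum>w\<in>neighbours x. shannon_entropy iid_uniform (\<lambda>z. (X x z, X w z)))"
proof -
  interpret independent_sources iid_uniform "exp 1" "\<lambda>(v :: 'v) z. D (z v)"
    by (rule independent_sources_iid_uniform[OF D])
  let ?B = "graph_ball E n"
  have det: "determined_by (X v) (?B v)" for v
    by (rule determined_byI[OF finite_graph_ball]) (rule block)
  note sX = simple_determined_by[OF det]
  define a where "a u v = contribution (X v) (?B v) u" for u v
  have inv: "cond_entropy (X (\<psi> v)) (\<psi> ` S) = cond_entropy (X v) S"
    if \<psi>: "\<psi> \<in> automorphisms E" and "finite S" for \<psi> v S
  proof -
    have "bij \<psi>" using \<psi> by (simp add: automorphisms_def)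
    note relabel = entropy_with_sources_relabel[OF independent_sources_axioms \<open>bij \<psi>\<close> \<open>finite S\<close>, unfolded shannon_entropy_def]
    \<comment> \<open>The same lemma with a constant in place of \<open>X v\<close> treats the entropy of the sources alone.\<close>
    have unit: "entropy_Pow (\<lambda>z. ((), joint T z)) = entropy_Pow (joint T)" if "finite T" for T
      by (rule entropy_eq_of_mutual_functions[where f = "Pair ()" and g = snd])
         (auto intro!: simple_function_Pair simple_joint that)
    have "entropy_Pow (\<lambda>z. (X (\<psi> v) z, joint (\<psi> ` S) z)) = entropy_Pow (\<lambda>z. (X v z, joint S z))"
      by (rule relabel[OF sX]) (rule equiv[OF \<psi>])
    moreover have "entropy_Pow (\<lambda>z. ((), joint (\<psi> ` S) z)) = entropy_Pow (\<lambda>z. ((), joint S z))"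
      by (rule relabel) (rule simple_function_const, rule refl)
    ultimately show ?thesis
      unfolding cond_entropy_def unit[OF \<open>finite S\<close>] unit[OF finite_imageI[OF \<open>finite S\<close>]] by (rule arg_cong2)
  qed
  have "(1 + \<tau>) * d * (\<Sum>u\<in>?B x. a u x) \<le> (\<Sum>w\<in>neighbours x. \<Sum>u\<in>?B x \<union> ?B w. max (a u x) (a u w))"
  proof (rule expansion_of_invariant_weights)
    show "0 \<le> a u v" for u v unfolding a_def by (rule contribution_nonneg[OF det])
    show "a u v \<noteq> 0 \<Longrightarrow> u \<in> ?B v" for u v by (auto simp: a_def contribution_def split: if_splits)
    show "a (\<psi> u) (\<psi> v) = a u v" if \<psi>: "\<psi> \<in> automorphisms E" for \<psi> u v
    proof -
      have "inj \<psi>" using \<psi> by (simp add: automorphisms_def bij_def)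
      have "shapley (cond_entropy (X (\<psi> v))) (\<psi> ` ?B v) (\<psi> u) = shapley (cond_entropy (X v)) (?B v) u"
      proof (rule shapley_image[OF \<open>inj \<psi>\<close>])
        fix S assume "S \<subseteq> insert u (?B v)"
        then have "finite S" by (rule finite_subset) (simp add: finite_graph_ball)
        then show "cond_entropy (X (\<psi> v)) (\<psi> ` S) = cond_entropy (X v) S" by (rule inv[OF \<psi>])
      qed
      then show ?thesis
        by (simp add: a_def contribution_def graph_ball_automorphism[OF \<psi>] inj_image_mem_iff[OF \<open>inj \<psi>\<close>])
    qed
  qed
  also have "\<dots> \<le> (\<Sum>w\<in>neighbours x. entropy_Pow (\<lambda>z. (X x z, X w z)))"
    unfolding a_def by (intro sum_mono sum_max_contribution_le det)
  finally show ?thesis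
    using sum_contribution[OF det, of x] by (simp add: a_def shannon_entropy_def)
qed

section \<open>Approximation by block events\<close>

text \<open>  An event that depends on finitely many coordinates, each of them discretised by \<open>D\<close>. The discretisation
  is an arbitrary simple function, so a cylinder over any measurable set is a block event exactly.\<close>

definition block_event :: "(real \<Rightarrow> nat) \<Rightarrow> 'v set \<Rightarrow> ('v \<Rightarrow> nat) set \<Rightarrow> ('v \<Rightarrow> real) set" where
  "block_event D J C = {z \<in> space iid_uniform. restrict (\<lambda>u. D (z u)) J \<in> C}"

lemma simple_pattern:
  fixes D :: "real \<Rightarrow> nat"
  assumes "simple_function uniform01 D" "finite J"
  shows "simple_function iid_uniform (\<lambda>z. restrict (\<lambda>u :: 'v. D (z u)) J)"
proof -
  interpret independent_sources iid_uniform "exp 1" "\<lambda>(v :: 'v) z. D (z v)"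
    by (rule independent_sources_iid_uniform[OF assms(1)])
  show ?thesis using simple_joint[OF assms(2)] by (simp add: joint_def[abs_def])
qed

lemma sets_block_event:
  assumes "simple_function uniform01 D" "finite J"
  shows "block_event D J C \<in> sets iid_uniform"
  using simple_functionD(2)[OF simple_pattern[OF assms], of C]
  by (simp add: block_event_def vimage_def Int_def conj_commute)

definition block_approximable :: "('v \<Rightarrow> real) set \<Rightarrow> bool" where
  "block_approximable A \<longleftrightarrow> (\<forall>\<epsilon>>0. \<exists>D J C. simple_function uniform01 D \<and> finite J \<and>
     measure iid_uniform (sym_diff A (block_event D J C)) < \<epsilon>)"

text \<open>  The product of two discretisations, encoded in one natural number, refines both.\<close>

lemma block_approximable_Un:
  assumes A: "block_approximable A" "A \<in> sets iid_uniform" and B: "block_approximable B" "B \<in> sets iid_uniform"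
  shows "block_approximable (A \<union> B)"
  unfolding block_approximable_def
proof (intro allI impI)
  interpret prob_space "iid_uniform :: ('a \<Rightarrow> real) measure" by (rule prob_space_iid_uniform)
  fix \<epsilon> :: real assume "\<epsilon> > 0"
  obtain D1 J1 C1 where 1: "simple_function uniform01 D1" "finite J1"
      "prob (sym_diff A (block_event D1 J1 C1)) < \<epsilon> / 2"
    using A \<open>\<epsilon> > 0\<close> unfolding block_approximable_def by (meson half_gt_zero)
  obtain D2 J2 C2 where 2: "simple_function uniform01 D2" "finite J2"
      "prob (sym_diff B (block_event D2 J2 C2)) < \<epsilon> / 2"
    using B \<open>\<epsilon> > 0\<close> unfolding block_approximable_def by (meson half_gt_zero)
  define D where "D x = prod_encode (D1 x, D2 x)" for x
  define C where "C = {g. restrict (\<lambda>u. fst (prod_decode (g u))) J1 \<in> C1 \<or> restrict (\<lambda>u. snd (prod_decode (g u))) J2 \<in> C2}"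
  have D: "simple_function uniform01 D"
    using simple_function_compose[OF simple_function_Pair[OF 1(1) 2(1)], of prod_encode]
    by (simp add: comp_def D_def[abs_def])
  have C: "block_event D (J1 \<union> J2) C = block_event D1 J1 C1 \<union> block_event D2 J2 C2"
  proof -
    have "restrict (\<lambda>u. fst (prod_decode (restrict (\<lambda>u. D (z u)) (J1 \<union> J2) u))) J1 = restrict (\<lambda>u. D1 (z u)) J1"
      "restrict (\<lambda>u. snd (prod_decode (restrict (\<lambda>u. D (z u)) (J1 \<union> J2) u))) J2 = restrict (\<lambda>u. D2 (z u)) J2" for z
      by (auto simp: D_def fun_eq_iff)
    then show ?thesis unfolding block_event_def C_def by auto
  qed
  note ev[measurable] = sets_block_event[OF 1(1,2), of C1] sets_block_event[OF 2(1,2), of C2] A(2) B(2)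
  have "prob (sym_diff (A \<union> B) (block_event D (J1 \<union> J2) C))
      \<le> prob (sym_diff A (block_event D1 J1 C1) \<union> sym_diff B (block_event D2 J2 C2))"
    unfolding C by (intro finite_measure_mono) auto
  also have "\<dots> \<le> prob (sym_diff A (block_event D1 J1 C1)) + prob (sym_diff B (block_event D2 J2 C2))"
    by (intro measure_Un_le) auto
  also have "\<dots> < \<epsilon>" using 1 2 by simp
  finally show "\<exists>D J C. simple_function uniform01 D \<and> finite J \<and> prob (sym_diff (A \<union> B) (block_event D J C)) < \<epsilon>"
    using D 1 2 by blast
qed

lemma block_approximable_empty: "block_approximable {}"
  unfolding block_approximable_def
  by (intro allI impI exI[of _ "\<lambda>_. 0"] exI[of _ "{}"]) (auto simp: block_event_def)

lemma block_approximable_UN: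
  assumes A: "\<And>i :: nat. block_approximable (A i)" "\<And>i. A i \<in> sets iid_uniform"
  shows "block_approximable (\<Union>i. A i)"
  unfolding block_approximable_def
proof (intro allI impI)
  interpret prob_space "iid_uniform :: ('a \<Rightarrow> real) measure" by (rule prob_space_iid_uniform)
  fix \<epsilon> :: real assume "\<epsilon> > 0"
  let ?B = "\<lambda>n. \<Union>i<n. A i"
  note [measurable] = A(2)
  have B: "block_approximable (?B n)" for n
  proof (induction n)
    case (Suc n)
    have "?B (Suc n) = ?B n \<union> A n" by (auto simp: lessThan_Suc)
    then show ?case using block_approximable_Un[OF Suc _ A] by simp
  qed (simp add: block_approximable_empty)
  have "(\<lambda>n. prob (?B n)) \<longlonglongrightarrow> prob (\<Union>n. ?B n)"
    by (intro finite_Lim_measure_incseq) (auto simp: incseq_def, force)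
  moreover have "(\<Union>n. ?B n) = (\<Union>i. A i)" by auto
  ultimately have "(\<lambda>n. prob (?B n)) \<longlonglongrightarrow> prob (\<Union>i. A i)" by simp
  then have "\<forall>\<^sub>F n in sequentially. prob (\<Union>i. A i) - \<epsilon> / 2 < prob (?B n)"
    using \<open>\<epsilon> > 0\<close> by (intro order_tendstoD) auto
  then obtain n where n: "prob (\<Union>i. A i) - \<epsilon> / 2 < prob (?B n)"
    using eventually_happens by force
  obtain D J C where 1: "simple_function uniform01 D" "finite J"
      "prob (sym_diff (?B n) (block_event D J C)) < \<epsilon> / 2"
    using B[of n] \<open>\<epsilon> > 0\<close> unfolding block_approximable_def by (meson half_gt_zero)
  note [measurable] = sets_block_event[OF 1(1,2), of C]
  have "prob (sym_diff (\<Union>i. A i) (block_event D J C))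
      \<le> prob (((\<Union>i. A i) - ?B n) \<union> sym_diff (?B n) (block_event D J C))"
    by (intro finite_measure_mono) auto
  also have "\<dots> \<le> prob ((\<Union>i. A i) - ?B n) + prob (sym_diff (?B n) (block_event D J C))"
    by (intro measure_Un_le) auto
  also have "prob ((\<Union>i. A i) - ?B n) = prob (\<Union>i. A i) - prob (?B n)"
    by (intro finite_measure_Diff) auto
  finally show "\<exists>D J C. simple_function uniform01 D \<and> finite J \<and> prob (sym_diff (\<Union>i. A i) (block_event D J C)) < \<epsilon>"
    using 1 n by (intro exI[of _ D] exI[of _ J] exI[of _ C]) auto
qed

text \<open>  The block-approximable events contain the cylinders that generate the product sigma-algebra, and they are
  closed under complements and countable unions.\<close>

lemma sets_block_approximable:
  fixes A :: "('v \<Rightarrow> real) set"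
  assumes "A \<in> sets iid_uniform"
  shows "block_approximable A"
proof -
  have gen: "sets (iid_uniform :: ('v \<Rightarrow> real) measure) = sigma_sets (space iid_uniform)
      {{z \<in> space iid_uniform. z v \<in> B} | v B. B \<in> sets uniform01}"
    by (subst sets_PiM_single) (simp add: space_PiM)
  have "A \<in> sigma_sets (space iid_uniform) {{z \<in> space iid_uniform. z v \<in> B} | v B. B \<in> sets uniform01}"
    using assms gen by simp
  then show ?thesis
  proof induction
    case (Basic A)
    then obtain v B where A: "A = {z \<in> space iid_uniform. z v \<in> B}" "B \<in> sets uniform01" by auto
    let ?D = "indicator B :: real \<Rightarrow> nat"
    have "simple_function uniform01 ?D" using A(2) by (rule simple_function_indicator)
    moreover have "block_event ?D {v} {g. g v = 1} = A"
      by (auto simp: block_event_def A indicator_def)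
    ultimately show ?case
      unfolding block_approximable_def by (intro allI impI exI[of _ ?D] exI[of _ "{v}"] exI[of _ "{g. g v = 1}"]) auto
  next
    case Empty
    show ?case by (rule block_approximable_empty)
  next
    case (Compl A)
    have "A \<subseteq> space iid_uniform" using Compl.hyps by (rule sigma_sets_into_sp[rotated]) auto
    then have "sym_diff (space iid_uniform - A) (block_event D J (- C)) = sym_diff A (block_event D J C)" for D J C
      by (auto simp: block_event_def)
    then show ?case using Compl.IH unfolding block_approximable_def by metis
  next
    case (Union A)
    have "A i \<in> sets iid_uniform" for i using Union.hyps by (simp only: gen)
    then show ?case using Union.IH by (intro block_approximable_UN)
  qed
qed

lemma (in prob_space) prob_eq_sum_over_values:
  assumes J: "simple_function M J" and S: "S \<in> events"
  shows "prob S = (\<Sum>g\<in>J ` space M. prob (S \<inter> J -` {g}))"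
proof -
  have "S = (\<Union>g\<in>J ` space M. S \<inter> J -` {g})"
    using sets.sets_into_space[OF S] by auto
  moreover have "S \<inter> J -` {g} \<in> events" for g
  proof -
    have "S \<inter> J -` {g} = S \<inter> (J -` {g} \<inter> space M)" using sets.sets_into_space[OF S] by auto
    then show ?thesis using S simple_functionD(2)[OF J] by auto
  qed
  then have "prob (\<Union>g\<in>J ` space M. S \<inter> J -` {g}) = (\<Sum>g\<in>J ` space M. prob (S \<inter> J -` {g}))"
    using simple_functionD(1)[OF J] by (intro finite_measure_finite_Union) (auto simp: disjoint_family_on_def)
  ultimately show ?thesis by simp
qed

text \<open>  Deciding on each cell of the partition into the values of \<open>J\<close> for \<open>A\<close> or against \<open>A\<close>, whichever is more
  likely, gives the best approximation of \<open>A\<close> by a \<open>J\<close>-measurable event. Besides being at least as good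
  as any other one, it involves no choice and is therefore invariant under all symmetries of \<open>A\<close> and \<open>J\<close>.\<close>

lemma (in prob_space) majority_vote_optimal:
  assumes J: "simple_function M J" and A: "A \<in> events"
  defines "A' \<equiv> {\<omega> \<in> space M. prob (J -` {J \<omega>} \<inter> space M - A) < prob (J -` {J \<omega>} \<inter> space M \<inter> A)}"
  shows "A' \<in> events" "prob (sym_diff A A') \<le> prob (sym_diff A (J -` C \<inter> space M))"
proof -
  define C' where "C' = {g. prob (J -` {g} \<inter> space M - A) < prob (J -` {g} \<inter> space M \<inter> A)}"
  have A': "A' = J -` C' \<inter> space M" by (auto simp: A'_def C'_def)
  have ev: "J -` B \<inter> space M \<in> events" for B using simple_functionD(2)[OF J] .
  then show "A' \<in> events" by (simp add: A')
  have A_sub: "A \<subseteq> space M" using A by (rule sets.sets_into_space)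
  have on_cell: "sym_diff A (J -` B \<inter> space M) \<inter> J -` {g}
     = (if g \<in> B then J -` {g} \<inter> space M - A else J -` {g} \<inter> space M \<inter> A)" for B g
    using A_sub by auto
  have "prob (sym_diff A A') = (\<Sum>g\<in>J ` space M. prob (sym_diff A (J -` C' \<inter> space M) \<inter> J -` {g}))"
    unfolding A' using A ev by (intro prob_eq_sum_over_values J) auto
  also have "\<dots> \<le> (\<Sum>g\<in>J ` space M. prob (sym_diff A (J -` C \<inter> space M) \<inter> J -` {g}))"
    unfolding on_cell by (intro sum_mono) (auto simp: C'_def)
  also have "\<dots> = prob (sym_diff A (J -` C \<inter> space M))"
    using A ev by (intro prob_eq_sum_over_values[symmetric] J) auto
  finally show "prob (sym_diff A A') \<le> prob (sym_diff A (J -` C \<inter> space M))" .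
qed

section \<open>Entropies of one and two events\<close>

text \<open>  \<open>eta\<close> is the entropy function. Its value at \<open>0\<close> is \<open>0\<close>, which makes it continuous on \<open>{0..}\<close>.\<close>

definition eta :: "real \<Rightarrow> real" where "eta x = - x * ln x"

lemma phi_eq_eta: "phi q = (2 * eta q + eta (1 - 2 * q)) / (eta q + eta (1 - q)) - 1"
proof -
  have "- 2 * q * ln q - (1 - 2 * q) * ln (1 - 2 * q) = 2 * eta q + eta (1 - 2 * q)"
    "- q * ln q - (1 - q) * ln (1 - q) = eta q + eta (1 - q)"
    by (simp_all add: eta_def algebra_simps)
  then show ?thesis unfolding phi_def by (simp only:)
qed

lemma continuous_on_eta: "continuous_on {0..} eta"
  unfolding continuous_on_eq_continuous_within
proof
  fix x :: real assume "x \<in> {0..}"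
  then consider "x = 0" | "x > 0" by force
  then show "continuous (at x within {0..}) eta"
  proof cases
    case 1
    have "((\<lambda>x :: real. - x * ln x) \<longlongrightarrow> 0) (at_right 0)" by real_asymp
    then show ?thesis
      by (simp add: 1 continuous_within at_within_Ici_at_right eta_def[abs_def])
  next
    case 2
    then have "isCont eta x" unfolding eta_def[abs_def] by (auto intro!: continuous_intros)
    then show ?thesis by (rule continuous_at_imp_continuous_at_within)
  qed
qed

lemma tendsto_eta:
  assumes "(f \<longlongrightarrow> l) F" "0 \<le> l" "\<And>k. 0 \<le> f k"
  shows "((\<lambda>k. eta (f k)) \<longlongrightarrow> eta l) F"
  using assms by (intro continuous_on_tendsto_compose[OF continuous_on_eta]) auto

lemma shannon_entropy_eq_sum:
  assumes "prob_space M" "simple_function M X" "finite R" "X ` space M \<subseteq> R"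
  shows "shannon_entropy M X = (\<Sum>x\<in>R. eta (measure M {\<omega> \<in> space M. X \<omega> = x}))"
proof -
  interpret prob_space M by fact
  interpret information_space M "exp 1" by unfold_locales simp
  have eq: "X -` {x} \<inter> space M = {\<omega> \<in> space M. X \<omega> = x}" for x by auto
  have "shannon_entropy M X = - (\<Sum>x\<in>X ` space M. prob (X -` {x} \<inter> space M) * log (exp 1) (prob (X -` {x} \<inter> space M)))"
    unfolding shannon_entropy_def
    by (rule entropy_simple_distributed[OF simple_distributedI[OF assms(2) measure_nonneg refl]])
  also have "\<dots> = (\<Sum>x\<in>X ` space M. eta (prob {\<omega> \<in> space M. X \<omega> = x}))"
    unfolding eq by (simp add: eta_def sum_negf log_def)
  also have "\<dots> = (\<Sum>x\<in>R. eta (prob {\<omega> \<in> space M. X \<omega> = x}))"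
  proof (rule sum.mono_neutral_left[OF assms(3,4)], intro ballI)
    fix x assume "x \<in> R - X ` space M"
    then have "{\<omega> \<in> space M. X \<omega> = x} = {}" by auto
    then show "eta (prob {\<omega> \<in> space M. X \<omega> = x}) = 0" by (simp add: eta_def del: Collect_empty_eq)
  qed
  finally show ?thesis .
qed

lemma simple_function_event:
  assumes "A \<in> sets M"
  shows "simple_function M (\<lambda>\<omega>. \<omega> \<in> A)"
  unfolding simple_function_def
proof (intro conjI ballI)
  fix x :: bool
  have "(\<lambda>\<omega>. \<omega> \<in> A) -` {x} \<inter> space M = (if x then A else space M - A)"
    using sets.sets_into_space[OF assms] by auto
  then show "(\<lambda>\<omega>. \<omega> \<in> A) -` {x} \<inter> space M \<in> sets M" using assms by simp
qed simp

lemma (in prob_space) shannon_entropy_event: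
  assumes A: "A \<in> events"
  shows "shannon_entropy M (\<lambda>\<omega>. \<omega> \<in> A) = eta (prob A) + eta (1 - prob A)"
proof -
  have "{\<omega> \<in> space M. \<omega> \<in> A} = A" "{\<omega> \<in> space M. \<omega> \<notin> A} = space M - A"
    using sets.sets_into_space[OF A] by auto
  then show ?thesis
    using shannon_entropy_eq_sum[OF prob_space_axioms simple_function_event[OF A] finite subset_UNIV] A
    by (simp add: UNIV_bool prob_compl)
qed

lemma (in prob_space) shannon_entropy_two_events:
  assumes A: "A \<in> events" and B: "B \<in> events"
  shows "shannon_entropy M (\<lambda>\<omega>. (\<omega> \<in> A, \<omega> \<in> B)) = eta (prob (A \<inter> B)) + eta (prob A - prob (A \<inter> B))
    + eta (prob B - prob (A \<inter> B)) + eta (1 - prob A - prob B + prob (A \<inter> B))"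
proof -
  have sp: "A \<subseteq> space M" "B \<subseteq> space M" using A B sets.sets_into_space by auto
  have "prob (A \<union> B) = prob A + prob B - prob (A \<inter> B)"
    using A B by (simp add: measure_Un3 fmeasurable_eq_sets)
  moreover have "prob {\<omega> \<in> space M. \<omega> \<notin> A \<and> \<omega> \<notin> B} = 1 - prob (A \<union> B)"
    using A B by (subst prob_compl[symmetric]) (auto intro!: arg_cong[where f = prob])
  ultimately have neither: "prob {\<omega> \<in> space M. \<omega> \<notin> A \<and> \<omega> \<notin> B} = 1 - prob A - prob B + prob (A \<inter> B)"
    by simp
  have only_A: "prob {\<omega> \<in> space M. \<omega> \<in> A \<and> \<omega> \<notin> B} = prob A - prob (A \<inter> B)"
    using A B sp by (subst finite_measure_Diff'[symmetric]) (auto intro!: arg_cong[where f = prob])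
  have only_B: "prob {\<omega> \<in> space M. \<omega> \<notin> A \<and> \<omega> \<in> B} = prob B - prob (A \<inter> B)"
    using A B sp by (subst Int_commute, subst finite_measure_Diff'[symmetric]) (auto intro!: arg_cong[where f = prob])
  have both: "{\<omega> \<in> space M. \<omega> \<in> A \<and> \<omega> \<in> B} = A \<inter> B" using sp by auto
  have UNIV: "(UNIV :: (bool \<times> bool) set) = {(True, True), (True, False), (False, True), (False, False)}"
    by auto
  show ?thesis
    using shannon_entropy_eq_sum[OF prob_space_axioms simple_function_Pair[OF simple_function_event[OF A]
          simple_function_event[OF B]] finite subset_UNIV]
    by (simp add: UNIV neither only_A only_B both)
qed

section \<open>The density bound\<close>

context unimodular_transitive_graph
begin

text \<open>
  \<open>A v\<close> is the event that \<open>v\<close> belongs to an equivariantly chosen random set of vertices.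
\<close>

context
  fixes A :: "'v \<Rightarrow> ('v \<Rightarrow> real) set"
  assumes A: "\<And>v. A v \<in> sets iid_uniform"
    and equiv: "\<And>\<psi> z v. \<psi> \<in> automorphisms E \<Longrightarrow> z \<in> space iid_uniform \<Longrightarrow> z \<circ> \<psi> \<in> A v \<longleftrightarrow> z \<in> A (\<psi> v)"
begin

interpretation prob_space "iid_uniform :: ('v \<Rightarrow> real) measure" by (rule prob_space_iid_uniform)

lemma prob_relabel:
  assumes \<psi>: "\<psi> \<in> automorphisms E" and S: "S \<in> events"
    and "T \<subseteq> space iid_uniform" "\<And>z. z \<in> space iid_uniform \<Longrightarrow> z \<in> T \<longleftrightarrow> z \<circ> \<psi> \<in> S"
  shows "prob T = prob S"
proof -
  have "bij \<psi>" using \<psi> by (simp add: automorphisms_def)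
  have "prob S = measure (distr iid_uniform iid_uniform (\<lambda>z. z \<circ> \<psi>)) S"
    by (simp add: distr_relabel[OF \<open>bij \<psi>\<close>])
  also have "\<dots> = prob ((\<lambda>z. z \<circ> \<psi>) -` S \<inter> space iid_uniform)"
    using S by (intro measure_distr relabel_measurable \<open>bij \<psi>\<close>)
  also have "(\<lambda>z. z \<circ> \<psi>) -` S \<inter> space iid_uniform = T"
    using assms(3,4) by auto
  finally show ?thesis ..
qed

definition cell :: "(real \<Rightarrow> nat) \<Rightarrow> nat \<Rightarrow> 'v \<Rightarrow> ('v \<Rightarrow> real) \<Rightarrow> ('v \<Rightarrow> real) set" where
  "cell D n v z = {z' \<in> space iid_uniform. \<forall>u\<in>graph_ball E n v. D (z' u) = D (z u)}"

definition majority :: "(real \<Rightarrow> nat) \<Rightarrow> nat \<Rightarrow> 'v \<Rightarrow> ('v \<Rightarrow> real) set" where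
  "majority D n v = {z \<in> space iid_uniform. prob (cell D n v z - A v) < prob (cell D n v z \<inter> A v)}"

lemma cell_eq_pattern:
  "cell D n v z = (\<lambda>z. restrict (\<lambda>u. D (z u)) (graph_ball E n v)) -` {restrict (\<lambda>u. D (z u)) (graph_ball E n v)} \<inter> space iid_uniform"
proof -
  have "restrict f S = restrict g S \<longleftrightarrow> (\<forall>u\<in>S. f u = g u)" for f g :: "'v \<Rightarrow> nat" and S
    by (metis restrict_apply' restrict_ext)
  then show ?thesis by (auto simp: cell_def)
qed

lemma sets_cell:
  assumes "simple_function uniform01 D"
  shows "cell D n v z \<in> events"
  unfolding cell_eq_pattern by (rule simple_functionD(2)[OF simple_pattern[OF assms finite_graph_ball]])

lemma majority_equivariant:
  assumes D: "simple_function uniform01 D" and \<psi>: "\<psi> \<in> automorphisms E" and z: "z \<in> space iid_uniform"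
  shows "z \<circ> \<psi> \<in> majority D n v \<longleftrightarrow> z \<in> majority D n (\<psi> v)"
proof -
  have sp: "z' \<circ> \<psi> \<in> space iid_uniform" if "z' \<in> space iid_uniform" for z'
    using that by (auto simp: space_iid_uniform)
  have mem: "z' \<in> cell D n (\<psi> v) z \<longleftrightarrow> z' \<circ> \<psi> \<in> cell D n v (z \<circ> \<psi>)" if "z' \<in> space iid_uniform" for z'
    using that sp[OF that] by (auto simp: cell_def graph_ball_automorphism[OF \<psi>])
  have "prob (cell D n (\<psi> v) z - A (\<psi> v)) = prob (cell D n v (z \<circ> \<psi>) - A v)"
    using sets_cell[OF D] A mem equiv[OF \<psi>] by (intro prob_relabel[OF \<psi>]) (auto simp: cell_def)
  moreover have "prob (cell D n (\<psi> v) z \<inter> A (\<psi> v)) = prob (cell D n v (z \<circ> \<psi>) \<inter> A v)"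
    using sets_cell[OF D] A mem equiv[OF \<psi>] by (intro prob_relabel[OF \<psi>]) (auto simp: cell_def)
  ultimately show ?thesis using z sp[OF z] by (simp add: majority_def)
qed

lemma sets_majority:
  assumes "simple_function uniform01 D"
  shows "majority D n v \<in> events"
  unfolding majority_def cell_eq_pattern
  by (rule majority_vote_optimal(1)[OF simple_pattern[OF assms finite_graph_ball] A])

lemma same_density: "prob (A v) = prob (A w)"
proof -
  obtain \<psi> where \<psi>: "\<psi> \<in> automorphisms E" "\<psi> w = v"
    using transitive unfolding vertex_transitive_def by blast
  show ?thesis
    using sets.sets_into_space[OF A[of v]] equiv[OF \<psi>(1), of _ w] \<psi>(2)
    by (intro prob_relabel[OF \<psi>(1) A]) auto
qed

text \<open>  A block event close to \<open>A x\<close> at one vertex \<open>x\<close> is replaced by the majority vote on a ball that contains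
  its coordinates. The votes at all vertices form an equivariant system, so the error is the same everywhere.\<close>

lemma majority_approximates:
  assumes "\<epsilon> > 0"
  obtains D n where "simple_function uniform01 D" "\<And>v. prob (sym_diff (A v) (majority D n v)) < \<epsilon>"
proof -
  fix x :: 'v
  obtain D J C where D: "simple_function uniform01 D" and J: "finite J"
      and C: "prob (sym_diff (A x) (block_event D J C)) < \<epsilon>"
    using sets_block_approximable[OF A[of x]] assms unfolding block_approximable_def by blast
  obtain n where n: "J \<subseteq> graph_ball E n x" using finite_subset_graph_ball[OF J] by blast
  let ?J = "\<lambda>z. restrict (\<lambda>u. D (z u)) (graph_ball E n x)"
  have "restrict (?J z) J = restrict (\<lambda>u. D (z u)) J" for z
    using n by (auto simp: fun_eq_iff restrict_def)
  then have "block_event D J C = ?J -` {g. restrict g J \<in> C} \<inter> space iid_uniform"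
    by (auto simp: block_event_def)
  then have x: "prob (sym_diff (A x) (majority D n x)) < \<epsilon>"
    using majority_vote_optimal(2)[OF simple_pattern[OF D finite_graph_ball[of n x]] A[of x], of "{g. restrict g J \<in> C}"] C
    unfolding majority_def cell_eq_pattern by simp
  have "prob (sym_diff (A v) (majority D n v)) < \<epsilon>" for v
  proof -
    obtain \<psi> where \<psi>: "\<psi> \<in> automorphisms E" "\<psi> x = v"
      using transitive unfolding vertex_transitive_def by blast
    have "prob (sym_diff (A v) (majority D n v)) = prob (sym_diff (A x) (majority D n x))"
    proof (rule prob_relabel[OF \<psi>(1)])
      show "sym_diff (A x) (majority D n x) \<in> events" using A sets_majority[OF D] by auto
      show "sym_diff (A v) (majority D n v) \<subseteq> space iid_uniform"
        using sets.sets_into_space[OF A[of v]] sets.sets_into_space[OF sets_majority[OF D, of n v]] by auto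
      show "z \<in> sym_diff (A v) (majority D n v) \<longleftrightarrow> z \<circ> \<psi> \<in> sym_diff (A x) (majority D n x)"
        if "z \<in> space iid_uniform" for z
        using equiv[OF \<psi>(1) that, of x] majority_equivariant[OF D \<psi>(1) that, of n x] \<psi>(2) by auto
    qed
    then show ?thesis using x by simp
  qed
  then show ?thesis using that D by blast
qed

lemma majority_edge_vertex_inequality:
  fixes n x
  assumes D: "simple_function uniform01 D"
  defines "p \<equiv> \<lambda>v. prob (majority D n v)" and "s \<equiv> \<lambda>w. prob (majority D n x \<inter> majority D n w)"
  shows "(1 + \<tau>) * d * (eta (p x) + eta (1 - p x))
    \<le> (\<Sum>w\<in>neighbours x. eta (s w) + eta (p x - s w) + eta (p w - s w) + eta (1 - p x - p w + s w))"
proof -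
  note M = sets_majority[OF D]
  have "(1 + \<tau>) * d * shannon_entropy iid_uniform (\<lambda>z. z \<in> majority D n x)
    \<le> (\<Sum>w\<in>neighbours x. shannon_entropy iid_uniform (\<lambda>z. (z \<in> majority D n x, z \<in> majority D n w)))"
  proof (rule edge_vertex_inequality[OF D, where X = "\<lambda>v z. z \<in> majority D n v" and n = n])
    fix v z z' assume z: "z \<in> space iid_uniform" "z' \<in> space iid_uniform"
      and "\<And>u. u \<in> graph_ball E n v \<Longrightarrow> D (z u) = D (z' u)"
    then have "cell D n v z = cell D n v z'" by (auto simp: cell_def)
    then show "(z \<in> majority D n v) = (z' \<in> majority D n v)" using z by (simp add: majority_def)
  qed (rule majority_equivariant[OF D])
  then show ?thesis
    unfolding p_def s_def shannon_entropy_event[OF M] shannon_entropy_two_events[OF M M] .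
qed

lemma prob_approx:
  assumes "S \<in> events" "T \<in> events"
  shows "\<bar>prob T - prob S\<bar> \<le> prob (sym_diff S T)"
proof -
  have "prob T \<le> prob (S \<union> sym_diff S T)" using assms by (intro finite_measure_mono) auto
  also have "\<dots> \<le> prob S + prob (sym_diff S T)" using assms by (intro measure_Un_le) auto
  finally have 1: "prob T \<le> prob S + prob (sym_diff S T)" .
  have "prob S \<le> prob (T \<union> sym_diff S T)" using assms by (intro finite_measure_mono) auto
  also have "\<dots> \<le> prob T + prob (sym_diff S T)" using assms by (intro measure_Un_le) auto
  finally show ?thesis using 1 by linarith
qed

text \<open>  The majority votes satisfy the edge-vertex inequality. They need not be exactly disjoint at
  adjacent vertices, but as the error tends to \<open>0\<close> the probability \<open>s w\<close> of their intersection does so too,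
  and \<open>eta\<close> is continuous. In the limit every edge has the joint law \<open>(q, q, 1 - 2q)\<close>.\<close>

theorem independent_event_entropy_bound:
  fixes x
  assumes indep: "\<And>u v. E u v \<Longrightarrow> prob (A u \<inter> A v) = 0"
  defines "q \<equiv> prob (A x)"
  shows "q \<le> 1/2" "(1 + \<tau>) * (eta q + eta (1 - q)) \<le> 2 * eta q + eta (1 - 2 * q)"
proof -
  have q: "prob (A v) = q" for v unfolding q_def by (rule same_density)
  have "neighbours x \<noteq> {}" using degree[of x] degree_pos by (metis card.empty less_irrefl)
  then obtain y where "E x y" by auto
  have "prob (A x \<union> A y) = 2 * q"
    using A indep[OF \<open>E x y\<close>] q by (simp add: measure_Un3 fmeasurable_eq_sets)
  then show half: "q \<le> 1/2" using prob_le_1[of "A x \<union> A y"] by simp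
  define approx where "approx \<epsilon> p s \<longleftrightarrow> (\<forall>v. \<bar>p v - q\<bar> \<le> \<epsilon>) \<and>
      (\<forall>w. 0 \<le> s w \<and> s w \<le> p x \<and> s w \<le> p w \<and> p x + p w - s w \<le> 1) \<and>
      (\<forall>w\<in>neighbours x. s w \<le> 2 * \<epsilon>) \<and>
      (1 + \<tau>) * d * (eta (p x) + eta (1 - p x))
        \<le> (\<Sum>w\<in>neighbours x. eta (s w) + eta (p x - s w) + eta (p w - s w) + eta (1 - p x - p w + s w))"
    for \<epsilon> and p s :: "'v \<Rightarrow> real"
  have ex: "\<exists>p s. approx \<epsilon> p s"
    if "\<epsilon> > 0" for \<epsilon>
  proof -
    obtain D n where D: "simple_function uniform01 D" and err: "\<And>v. prob (sym_diff (A v) (majority D n v)) < \<epsilon>"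
      using majority_approximates[OF \<open>\<epsilon> > 0\<close>] by blast
    let ?M = "majority D n"
    note M = sets_majority[OF D, of n]
    show ?thesis
      unfolding approx_def
    proof (rule exI[of _ "\<lambda>v. prob (?M v)"], rule exI[of _ "\<lambda>w. prob (?M x \<inter> ?M w)"], intro conjI allI ballI)
      show "\<bar>prob (?M v) - q\<bar> \<le> \<epsilon>" for v
        using prob_approx[OF A M, of v v] err[of v] q[of v] by simp
      show "prob (?M x \<inter> ?M w) \<le> prob (?M x)" for w
        using M by (auto intro!: finite_measure_mono)
      show "prob (?M x \<inter> ?M w) \<le> prob (?M w)" for w
        using M by (auto intro!: finite_measure_mono)
      have "prob (?M x \<union> ?M w) = prob (?M x) + prob (?M w) - prob (?M x \<inter> ?M w)" for w
        using M by (simp add: measure_Un3 fmeasurable_eq_sets)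
      then show "prob (?M x) + prob (?M w) - prob (?M x \<inter> ?M w) \<le> 1" for w
        using prob_le_1[of "?M x \<union> ?M w"] by simp
      show "prob (?M x \<inter> ?M w) \<le> 2 * \<epsilon>" if "w \<in> neighbours x" for w
      proof -
        let ?S = "\<lambda>v. sym_diff (A v) (?M v)"
        have S: "?S v \<in> events" for v using A M by auto
        have "prob (?M x \<inter> ?M w) \<le> prob (A x \<inter> A w \<union> (?S x \<union> ?S w))"
          using A M S by (intro finite_measure_mono) auto
        also have "\<dots> \<le> prob (A x \<inter> A w) + prob (?S x \<union> ?S w)"
          using A M S by (intro measure_Un_le) auto
        also have "prob (?S x \<union> ?S w) \<le> prob (?S x) + prob (?S w)"
          using S by (intro measure_Un_le) auto
        finally show ?thesis using indep[of x w] that err[of x] err[of w] by simp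
      qed
      show "(1 + \<tau>) * d * (eta (prob (?M x)) + eta (1 - prob (?M x)))
          \<le> (\<Sum>w\<in>neighbours x. eta (prob (?M x \<inter> ?M w)) + eta (prob (?M x) - prob (?M x \<inter> ?M w))
             + eta (prob (?M w) - prob (?M x \<inter> ?M w)) + eta (1 - prob (?M x) - prob (?M w) + prob (?M x \<inter> ?M w)))"
        by (rule majority_edge_vertex_inequality[OF D])
    qed (simp add: measure_nonneg)
  qed
  have "\<exists>p s. approx (inverse (real (Suc k))) p s" for k by (rule ex) simp
  then obtain p s where ps: "\<And>k. approx (inverse (real (Suc k))) (p k) (s k)" by metis
  have p: "\<bar>p k v - q\<bar> \<le> inverse (real (Suc k))"
    and s: "0 \<le> s k w \<and> s k w \<le> p k x \<and> s k w \<le> p k w \<and> p k x + p k w - s k w \<le> 1" for k v w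
    using ps[of k] unfolding approx_def by blast+
  have s0: "s k w \<le> 2 * inverse (real (Suc k))" if "w \<in> neighbours x" for k w
    using ps[of k] that unfolding approx_def by blast
  have ineq: "(1 + \<tau>) * d * (eta (p k x) + eta (1 - p k x))
      \<le> (\<Sum>w\<in>neighbours x. eta (s k w) + eta (p k x - s k w) + eta (p k w - s k w) + eta (1 - p k x - p k w + s k w))" for k
    using ps[of k] unfolding approx_def by blast
  have p_lim: "(\<lambda>k. p k v) \<longlonglongrightarrow> q" for v
  proof (rule LIM_zero_cancel, rule Lim_null_comparison)
    show "\<forall>\<^sub>F k in sequentially. norm (p k v - q) \<le> inverse (real (Suc k))" using p by simp
  qed (rule LIMSEQ_inverse_real_of_nat)
  have s_lim: "(\<lambda>k. s k w) \<longlonglongrightarrow> 0" if "w \<in> neighbours x" for w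
  proof (rule Lim_null_comparison)
    show "\<forall>\<^sub>F k in sequentially. norm (s k w) \<le> 2 * inverse (real (Suc k))" using s s0[OF that] by simp
    show "(\<lambda>k. 2 * inverse (real (Suc k))) \<longlonglongrightarrow> 0"
      using tendsto_mult_right_zero[OF LIMSEQ_inverse_real_of_nat, of 2] by simp
  qed
  have q0: "0 \<le> q" by (simp add: q_def)
  have p01: "0 \<le> p k x" "p k x \<le> 1" for k using s[of k x] s[of k y] by auto
  have "(\<lambda>k. (1 + \<tau>) * d * (eta (p k x) + eta (1 - p k x))) \<longlonglongrightarrow> (1 + \<tau>) * d * (eta q + eta (1 - q))"
    using half q0 p01 by (intro tendsto_intros tendsto_eta p_lim) auto
  moreover have "(\<lambda>k. \<Sum>w\<in>neighbours x. eta (s k w) + eta (p k x - s k w) + eta (p k w - s k w) + eta (1 - p k x - p k w + s k w))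
      \<longlonglongrightarrow> (\<Sum>w\<in>neighbours x. eta 0 + eta (q - 0) + eta (q - 0) + eta (1 - q - q + 0))"
    using half q0 s by (intro tendsto_intros tendsto_eta p_lim s_lim) (auto simp: algebra_simps)
  ultimately have "(1 + \<tau>) * d * (eta q + eta (1 - q)) \<le> (\<Sum>w\<in>neighbours x. eta 0 + eta (q - 0) + eta (q - 0) + eta (1 - q - q + 0))"
    by (rule LIMSEQ_le) (use ineq in auto)
  also have "\<dots> = d * (2 * eta q + eta (1 - 2 * q))"
    using degree[of x] by (simp add: eta_def)
  finally show "(1 + \<tau>) * (eta q + eta (1 - q)) \<le> 2 * eta q + eta (1 - 2 * q)"
    using degree_pos by (simp add: mult.assoc mult.left_commute[of _ "real d"])
qed

end

text \<open>  The joint law of the variables \<open>Z v\<close> is the product measure, so the density and the disjointness of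
  adjacent events can be computed there.\<close>

theorem density_le_phi_inv:
  assumes "factor_of_iid_independent_set E P X"
  shows "density_at P X v \<le> phi_inv \<tau>"
proof -
  interpret \<mu>: prob_space "iid_uniform :: ('v \<Rightarrow> real) measure" by (rule prob_space_iid_uniform)
  obtain Z F where "prob_space P" and indep: "prob_space.indep_vars P (\<lambda>_. uniform01) Z UNIV"
    and unif: "\<And>v. distr P uniform01 (Z v) = uniform01"
    and F: "F \<in> iid_uniform \<rightarrow>\<^sub>M (\<Pi>\<^sub>M v\<in>UNIV. count_space {0, 1})"
    and equiv: "equivariant E F" and X: "\<And>\<omega> v. \<omega> \<in> space P \<Longrightarrow> X v \<omega> = F (\<lambda>u. Z u \<omega>) v"
    and ind: "\<And>u v. E u v \<Longrightarrow> AE \<omega> in P. \<not> (X u \<omega> = 1 \<and> X v \<omega> = 1)"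
    using assms unfolding factor_of_iid_independent_set_def factor_of_iid_def by blast
  interpret P: prob_space P by fact
  have Z: "Z v \<in> P \<rightarrow>\<^sub>M uniform01" for v using indep by (simp add: P.indep_vars_def)
  have ZZ: "(\<lambda>\<omega> u. Z u \<omega>) \<in> P \<rightarrow>\<^sub>M iid_uniform"
  proof -
    have "(\<lambda>\<omega>. \<lambda>u\<in>UNIV. Z u \<omega>) \<in> P \<rightarrow>\<^sub>M iid_uniform" by (intro measurable_restrict Z)
    then show ?thesis by (simp add: restrict_def)
  qed
  have law: "distr P iid_uniform (\<lambda>\<omega> u. Z u \<omega>) = iid_uniform"
    using P.indep_vars_iff_distr_eq_PiM[where I = UNIV and M' = "\<lambda>_. uniform01" and X = Z] Z indep
    by (simp add: unif restrict_def)
  define A where "A v = {z \<in> space iid_uniform. F z v = 1}" for v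
  have A: "A v \<in> sets iid_uniform" for v
  proof -
    have "(\<lambda>z. F z v) \<in> iid_uniform \<rightarrow>\<^sub>M count_space {0, 1}"
      by (rule measurable_compose[OF F]) (rule measurable_component_singleton, simp)
    from measurable_sets[OF this, of "{1}"] show ?thesis
      by (simp add: A_def vimage_def Int_def conj_commute)
  qed
  have A_equiv: "z \<circ> \<psi> \<in> A v \<longleftrightarrow> z \<in> A (\<psi> v)" if "\<psi> \<in> automorphisms E" "z \<in> space iid_uniform" for \<psi> z v
  proof -
    have "F (z \<circ> \<psi>) v = F z (\<psi> v)"
      using equiv that unfolding equivariant_def space_iid_uniform by (metis comp_apply)
    then show ?thesis using that by (auto simp: A_def space_iid_uniform)
  qed
  have transfer: "\<mu>.prob B = P.prob {\<omega> \<in> space P. (\<lambda>u. Z u \<omega>) \<in> B}" if "B \<in> sets iid_uniform" for B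
    using measure_distr[OF ZZ that] unfolding law by (simp add: vimage_def Int_def conj_commute)
  have Z_sp: "(\<lambda>u. Z u \<omega>) \<in> space iid_uniform" if "\<omega> \<in> space P" for \<omega>
    using measurable_space[OF ZZ that] .
  have dens: "density_at P X v = \<mu>.prob (A v)" for v
    unfolding density_at_def transfer[OF A]
    by (intro arg_cong[where f = P.prob]) (use X Z_sp in \<open>auto simp: A_def\<close>)
  have null: "\<mu>.prob (A u \<inter> A v) = 0" if "E u v" for u v
  proof -
    have "A u \<inter> A v \<in> sets iid_uniform" using A by blast
    then have "\<mu>.prob (A u \<inter> A v) = P.prob {\<omega> \<in> space P. (\<lambda>u. Z u \<omega>) \<in> A u \<inter> A v}"
      by (rule transfer)
    also have "\<dots> = 0"
    proof (rule P.prob_eq_0_AE)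
      show "AE \<omega> in P. (\<lambda>u. Z u \<omega>) \<notin> A u \<inter> A v"
        using ind[OF that] AE_space by eventually_elim (use X in \<open>auto simp: A_def\<close>)
    qed
    finally show ?thesis .
  qed
  define q where "q = \<mu>.prob (A v)"
  note bound = independent_event_entropy_bound[OF A A_equiv null, of v, folded q_def]
  have "q \<le> phi_inv \<tau>"
  proof (rule le_phi_inv)
    show "\<tau> = 0" if "q = 1/2"
    proof -
      have "(1 + \<tau>) * ln 2 \<le> ln 2"
        using bound(2) unfolding that by (simp add: eta_def ln_div)
      then have "\<tau> * ln 2 \<le> 0" by (simp add: algebra_simps)
      then show ?thesis using cheeger_nonneg by (simp add: mult_le_0_iff)
    qed
    show "\<tau> \<le> phi q" if "0 < q" "q < 1/2"
    proof -
      have "0 < eta q + eta (1 - q)" using phi_denominator_pos[of q] that by (simp add: eta_def algebra_simps)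
      then have "1 + \<tau> \<le> (2 * eta q + eta (1 - 2 * q)) / (eta q + eta (1 - q))"
        using bound(2) by (simp add: pos_le_divide_eq)
      then show ?thesis by (simp add: phi_eq_eta)
    qed
  qed (use bound(1) cheeger_nonneg cheeger_le_1 in \<open>auto simp: q_def\<close>)
  then show ?thesis by (simp add: dens q_def)
qed

end

theorem theorem3:
  shows "continuous_on {0<..<1/2} phi \<and>
    strict_antimono_on {0<..<1/2} phi \<and>
    phi ` {0<..<1/2} = {0<..<1} \<and>
    (\<forall>(E :: 'v \<Rightarrow> 'v \<Rightarrow> bool) (d :: nat) (P :: 'w measure) (X :: 'v \<Rightarrow> 'w \<Rightarrow> nat).
       unimodular_transitive_graph E d \<longrightarrow>
       factor_of_iid_independent_set E P X \<longrightarrow>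
       (\<forall>v. density_at P X v \<le> phi_inv (cheeger_constant E d)))"
proof (intro conjI allI impI)
  show "continuous_on {0<..<1/2} phi" by (rule continuous_on_phi)
  show "strict_antimono_on {0<..<1/2} phi" by (intro monotone_onI phi_less) auto
  show "phi ` {0<..<1/2} = {0<..<1}" by (rule phi_image)
qed (rule unimodular_transitive_graph.density_le_phi_inv)

end
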